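(* Let $M^2$ be a marginally trapped surface in $\mathbb R^4_1$ such that $K^2+\varkappa^2\neq\mu^2$ at each point (equivalently, $4\nu^2+4\lambda^2-1\neq 0$ at each point), where $K$ is the Gauss curvature, $\varkappa$ the curvature of the normal connection, and $\nu,\lambda,\mu$ the geometric functions of $M^2$. Then $M^2$ locally admits canonical principal parameters; that is, for given constants $c_1,c_2\in\mathbb R$, every point $p\in M^2$ has a neighbourhood which can be parametrized by principal parameters $(u,v)$ that are canonical with respect to the base point $p$ and the constants $c_1,c_2$.
   Context: $\mathbb R^4_1$ is $\mathbb R^4$ with the metric $\langle\cdot,\cdot\rangle=dx_1^2+dx_2^2+dx_3^2-dx_4^2$, with flat connection $\nabla'$. All objects are smooth. A surface $M^2\subset\mathbb R^4_1$ is spacelike if the induced metric is Riemannian; $\sigma$ denotes its second fundamental tensor, $D$ its normal connection, and $H=\frac12\operatorname{tr}\sigma$ its mean curvature vector. A spacelike surface is marginally trapped if $H\neq0$ and $\langle H,H\rangle=0$ at each point. Principal parameters and geometric functions. Local parameters $(u,v)$, $z=z(u,v)$, on a marginally trapped surface are called principal if they are orthogonal ($F=\langle z_u,z_v\rangle=0$) and, with $E=\langle z_u,z_u\rangle$, $G=\langle z_v,z_v\rangle$, $x=z_u/\sqrt E$, $y=z_v/\sqrt G$, $n_1=H$, and $n_2$ the normal vector field with $\langle n_2,n_2\rangle=0$, $\langle n_1,n_2\rangle=-1$, one has $$\sigma(x,x)=(1+\nu)n_1,\qquad \sigma(x,y)=\lambda n_1+\mu n_2,\qquad \sigma(y,y)=(1-\nu)n_1$$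 for some functions $\nu,\lambda,\mu$ with $\mu\neq0$ at each point. The functions $\nu,\lambda,\mu$ are geometric functions of the surface. Standing assumption: on the marginally trapped surfaces considered, principal parameters (with $\mu\ne0$) exist in a neighbourhood of each point. The Gauss curvature and the curvature of the normal connection are $K=2\lambda\mu$ and $\varkappa=-2\mu\nu$. When $4\nu^2+4\lambda^2-1\neq0$, define with respect to principal parameters $(u,v)$ (subscripts denote partial derivatives) $$\phi_1=-\frac{\mu(\lambda^2+\nu^2-\nu)_v+(2(\lambda^2+\nu^2)+\nu-1)\mu_v}{2\mu(4\nu^2+4\lambda^2-1)},\qquad \phi_2=\frac{2\mu(\lambda_u\nu-\lambda\nu_u)+\lambda\mu_u-\lambda_u\mu}{2\mu(4\nu^2+4\lambda^2-1)},$$ $$\phi_3=\frac{2\mu(\lambda\nu_v-\lambda_v\nu)+\lambda\mu_v-\lambda_v\mu}{2\mu(4\nu^2+4\lambda^2-1)},\qquad \phi_4=-\frac{\mu(\lambda^2+\nu^2+\nu)_u+(2(\lambda^2+\nu^2)-\nu-1)\mu_u}{2\mu(4\nu^2+4\lambda^2-1)}.$$ Canonical parameters. Let $(u,v)$ be principal parameters on a product of open intervals containing $(u_0,v_0)$ (the coordinates of the base point), and let $c_1,c_2$ be constants. Put $$\varphi=\sqrt E\,\exp\Big(-\int_{v_0}^v\big(\phi_1+\phi_2\tfrac{\sqrt G}{\sqrt E}\big)(u,s)\,ds-\int_{u_0}^u\big(\phi_3\tfrac{\sqrt E}{\sqrt G}+\phi_4\big)(t,v_0)\,dt+c_1\Big),$$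 $$\psi=\sqrt G\,\exp\Big(-\int_{u_0}^u\big(\phi_3\tfrac{\sqrt E}{\sqrt G}+\phi_4\big)(t,v)\,dt-\int_{v_0}^v\big(\phi_1+\phi_2\tfrac{\sqrt G}{\sqrt E}\big)(u_0,s)\,ds+c_2\Big).$$ (The function $\varphi$ depends only on $u$ and $\psi$ depends only on $v$.) The principal parameters $(u,v)$ are called canonical principal parameters (with respect to the base point and $c_1,c_2$) if $\varphi\equiv1$ and $\psi\equiv1$. *)

theory Defs
  imports "HOL-Analysis.Analysis"
begin

text \<open>Calculus in the parameter plane. A function of two parameters is a function on
  pairs.\<close>

definition Du :: "(real \<times> real \<Rightarrow> 'a::real_normed_vector) \<Rightarrow> real \<times> real \<Rightarrow> 'a" where
  "Du f p = vector_derivative (\<lambda>s. f (s, snd p)) (at (fst p))"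

definition Dv :: "(real \<times> real \<Rightarrow> 'a::real_normed_vector) \<Rightarrow> real \<times> real \<Rightarrow> 'a" where
  "Dv f p = vector_derivative (\<lambda>t. f (fst p, t)) (at (snd p))"

text \<open>Meant for open \<open>U\<close>: \<open>Ck_on k U f\<close> says that \<open>f\<close> is of class \<open>C\<^sup>k\<close> on \<open>U\<close>.\<close>

fun Ck_on :: "nat \<Rightarrow> (real \<times> real) set \<Rightarrow> (real \<times> real \<Rightarrow> 'a::real_normed_vector) \<Rightarrow> bool" where
  "Ck_on 0 U f \<longleftrightarrow> continuous_on U f"
| "Ck_on (Suc k) U f \<longleftrightarrow> f differentiable_on U \<and> Ck_on k U (Du f) \<and> Ck_on k U (Dv f)"

definition smooth_on :: "(real \<times> real) set \<Rightarrow> (real \<times> real \<Rightarrow> 'a::real_normed_vector) \<Rightarrow> bool" where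
  "smooth_on U f \<longleftrightarrow> (\<forall>k. Ck_on k U f)"

definition mink :: "real^4 \<Rightarrow> real^4 \<Rightarrow> real" where
  "mink a b = a $ 1 * b $ 1 + a $ 2 * b $ 2 + a $ 3 * b $ 3 - a $ 4 * b $ 4"

text \<open>Surfaces. A surface is an embedded one, i.e. a subset of the ambient space covered by
  the images of smooth local parametrizations.\<close>

definition local_param ::
  "(real^4) set \<Rightarrow> (real \<times> real) set \<Rightarrow> (real \<times> real \<Rightarrow> real^4) \<Rightarrow> bool" where
  "local_param M U z \<longleftrightarrow>
     open U \<and> smooth_on U z \<and>
     (\<forall>p\<in>U. inj (frechet_derivative z (at p))) \<and>
     openin (top_of_set M) (z ` U) \<and>
     (\<exists>w. homeomorphism U (z ` U) z w)"

definition surface :: "(real^4) set \<Rightarrow> bool" where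
  "surface M \<longleftrightarrow> (\<forall>q\<in>M. \<exists>U z. local_param M U z \<and> q \<in> z ` U)"

definition tangent_plane :: "(real \<times> real \<Rightarrow> real^4) \<Rightarrow> real \<times> real \<Rightarrow> (real^4) set" where
  "tangent_plane z p = span {Du z p, Dv z p}"

definition normal_plane :: "(real \<times> real \<Rightarrow> real^4) \<Rightarrow> real \<times> real \<Rightarrow> (real^4) set" where
  "normal_plane z p = {n. \<forall>t\<in>tangent_plane z p. mink n t = 0}"

definition spacelike_surface :: "(real^4) set \<Rightarrow> bool" where
  "spacelike_surface M \<longleftrightarrow> surface M \<and>
     (\<forall>U z. local_param M U z \<longrightarrow>
        (\<forall>p\<in>U. \<forall>t\<in>tangent_plane z p. t \<noteq> 0 \<longrightarrow> 0 < mink t t))"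

definition coefE :: "(real \<times> real \<Rightarrow> real^4) \<Rightarrow> real \<times> real \<Rightarrow> real" where
  "coefE z p = mink (Du z p) (Du z p)"

definition coefF :: "(real \<times> real \<Rightarrow> real^4) \<Rightarrow> real \<times> real \<Rightarrow> real" where
  "coefF z p = mink (Du z p) (Dv z p)"

definition coefG :: "(real \<times> real \<Rightarrow> real^4) \<Rightarrow> real \<times> real \<Rightarrow> real" where
  "coefG z p = mink (Dv z p) (Dv z p)"

definition tan_part :: "(real \<times> real \<Rightarrow> real^4) \<Rightarrow> real \<times> real \<Rightarrow> real^4 \<Rightarrow> real^4" where
  "tan_part z p w = (THE t. t \<in> tangent_plane z p \<and> w - t \<in> normal_plane z p)"

definition nor_part :: "(real \<times> real \<Rightarrow> real^4) \<Rightarrow> real \<times> real \<Rightarrow> real^4 \<Rightarrow> real^4" where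
  "nor_part z p w = w - tan_part z p w"

text \<open>The second fundamental tensor \<open>\<sigma>(X,Y)\<close>, the normal part of the flat derivative of \<open>Y\<close>
  along \<open>X\<close>. The tangent vectors are given by their coordinates, so \<open>(a, b)\<close> stands for
  \<open>a z\<^sub>u + b z\<^sub>v\<close>.\<close>

definition sff ::
  "(real \<times> real \<Rightarrow> real^4) \<Rightarrow> real \<times> real \<Rightarrow> real \<times> real \<Rightarrow> real \<times> real \<Rightarrow> real^4" where
  "sff z p X Y = nor_part z p
     ((fst X * fst Y) *\<^sub>R Du (Du z) p
      + (fst X * snd Y) *\<^sub>R Du (Dv z) p
      + (snd X * fst Y) *\<^sub>R Dv (Du z) p
      + (snd X * snd Y) *\<^sub>R Dv (Dv z) p)"

text \<open>\<open>H = 1/2 tr \<sigma>\<close>; the trace is taken with respect to the induced metric, i.e. it is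
  \<open>g\<^sup>i\<^sup>j \<sigma>\<^sub>i\<^sub>j\<close> with \<open>g\<^sup>i\<^sup>j\<close> the inverse of the matrix with rows \<open>(E, F)\<close>, \<open>(F, G)\<close>.\<close>

definition mean_curv :: "(real \<times> real \<Rightarrow> real^4) \<Rightarrow> real \<times> real \<Rightarrow> real^4" where
  "mean_curv z p =
     (1 / (2 * (coefE z p * coefG z p - (coefF z p)\<^sup>2))) *\<^sub>R
       (coefG z p *\<^sub>R sff z p (1, 0) (1, 0)
        - (2 * coefF z p) *\<^sub>R sff z p (1, 0) (0, 1)
        + coefE z p *\<^sub>R sff z p (0, 1) (0, 1))"

definition marginally_trapped :: "(real^4) set \<Rightarrow> bool" where
  "marginally_trapped M \<longleftrightarrow> spacelike_surface M \<and>
     (\<forall>U z. local_param M U z \<longrightarrow>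
        (\<forall>p\<in>U. mean_curv z p \<noteq> 0 \<and> mink (mean_curv z p) (mean_curv z p) = 0))"

text \<open>The normal null frame \<open>n\<^sub>1 = H\<close> and \<open>n\<^sub>2\<close>.\<close>

definition n1 :: "(real \<times> real \<Rightarrow> real^4) \<Rightarrow> real \<times> real \<Rightarrow> real^4" where
  "n1 z p = mean_curv z p"

definition n2 :: "(real \<times> real \<Rightarrow> real^4) \<Rightarrow> real \<times> real \<Rightarrow> real^4" where
  "n2 z p = (THE n. n \<in> normal_plane z p \<and> mink n n = 0 \<and> mink (n1 z p) n = -1)"

text \<open>The induced Levi-Civita connection and the normal connection are the tangential and
  the normal part of the flat connection. Below they act on tangent, respectively normal,
  vector fields along \<open>z\<close>, in the direction of \<open>z\<^sub>u\<close> and \<open>z\<^sub>v\<close>.\<close>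

definition nabla_u ::
  "(real \<times> real \<Rightarrow> real^4) \<Rightarrow> (real \<times> real \<Rightarrow> real^4) \<Rightarrow> real \<times> real \<Rightarrow> real^4" where
  "nabla_u z W p = tan_part z p (Du W p)"

definition nabla_v ::
  "(real \<times> real \<Rightarrow> real^4) \<Rightarrow> (real \<times> real \<Rightarrow> real^4) \<Rightarrow> real \<times> real \<Rightarrow> real^4" where
  "nabla_v z W p = tan_part z p (Dv W p)"

definition nconn_u ::
  "(real \<times> real \<Rightarrow> real^4) \<Rightarrow> (real \<times> real \<Rightarrow> real^4) \<Rightarrow> real \<times> real \<Rightarrow> real^4" where
  "nconn_u z W p = nor_part z p (Du W p)"

definition nconn_v ::
  "(real \<times> real \<Rightarrow> real^4) \<Rightarrow> (real \<times> real \<Rightarrow> real^4) \<Rightarrow> real \<times> real \<Rightarrow> real^4" where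
  "nconn_v z W p = nor_part z p (Dv W p)"

text \<open>\<open>K\<close> is \<open>\<langle>R(x,y)y,x\<rangle>\<close> and \<open>\<kappa>\<close> is \<open>\<langle>R\<^sup>D(x,y)n\<^sub>2,n\<^sub>1\<rangle>\<close> for a positively oriented
  orthonormal tangent frame \<open>x, y\<close>, where \<open>R(X,Y) = [\<nabla>\<^sub>X,\<nabla>\<^sub>Y] - \<nabla>\<^bsub>[X,Y]\<^esub>\<close> and likewise for \<open>R\<^sup>D\<close>.
  They are computed from the commuting fields \<open>z\<^sub>u\<close>, \<open>z\<^sub>v\<close>, whose area form is the square root
  of \<open>E G - F\<^sup>2\<close>.\<close>

definition gauss_curv :: "(real \<times> real \<Rightarrow> real^4) \<Rightarrow> real \<times> real \<Rightarrow> real" where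
  "gauss_curv z p =
     mink (nabla_u z (nabla_v z (Dv z)) p - nabla_v z (nabla_u z (Dv z)) p) (Du z p)
     / (coefE z p * coefG z p - (coefF z p)\<^sup>2)"

definition normal_curv :: "(real \<times> real \<Rightarrow> real^4) \<Rightarrow> real \<times> real \<Rightarrow> real" where
  "normal_curv z p =
     mink (nconn_u z (nconn_v z (n2 z)) p - nconn_v z (nconn_u z (n2 z)) p) (n1 z p)
     / sqrt (coefE z p * coefG z p - (coefF z p)\<^sup>2)"

text \<open>Local parameters \<open>z\<close> on \<open>U\<close> are principal, with geometric functions \<open>\<nu>\<close>, \<open>l\<close>
  (the \<open>\<lambda>\<close> of the theory) and \<open>\<mu>\<close>. The unit fields \<open>x = z\<^sub>u/\<surd>E\<close>, \<open>y = z\<^sub>v/\<surd>G\<close> enter \<open>\<sigma>\<close> through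
  their coordinates.\<close>

definition principal_params ::
  "(real^4) set \<Rightarrow> (real \<times> real) set \<Rightarrow> (real \<times> real \<Rightarrow> real^4) \<Rightarrow>
   (real \<times> real \<Rightarrow> real) \<Rightarrow> (real \<times> real \<Rightarrow> real) \<Rightarrow> (real \<times> real \<Rightarrow> real) \<Rightarrow> bool" where
  "principal_params M U z \<nu> l \<mu> \<longleftrightarrow>
     local_param M U z \<and> smooth_on U \<nu> \<and> smooth_on U l \<and> smooth_on U \<mu> \<and>
     (\<forall>p\<in>U. coefF z p = 0 \<and>
        (let x = (1 / sqrt (coefE z p), 0); y = (0, 1 / sqrt (coefG z p)) in
           sff z p x x = (1 + \<nu> p) *\<^sub>R n1 z p \<and>
           sff z p x y = l p *\<^sub>R n1 z p + \<mu> p *\<^sub>R n2 z p \<and>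
           sff z p y y = (1 - \<nu> p) *\<^sub>R n1 z p) \<and>
        \<mu> p \<noteq> 0)"

definition phi1 :: "(real \<times> real \<Rightarrow> real) \<Rightarrow> (real \<times> real \<Rightarrow> real) \<Rightarrow> (real \<times> real \<Rightarrow> real) \<Rightarrow>
    real \<times> real \<Rightarrow> real" where
  "phi1 \<nu> l \<mu> p =
     - ((\<mu> p * Dv (\<lambda>q. (l q)\<^sup>2 + (\<nu> q)\<^sup>2 - \<nu> q) p
         + (2 * ((l p)\<^sup>2 + (\<nu> p)\<^sup>2) + \<nu> p - 1) * Dv \<mu> p)
        / (2 * \<mu> p * (4 * (\<nu> p)\<^sup>2 + 4 * (l p)\<^sup>2 - 1)))"

definition phi2 :: "(real \<times> real \<Rightarrow> real) \<Rightarrow> (real \<times> real \<Rightarrow> real) \<Rightarrow> (real \<times> real \<Rightarrow> real) \<Rightarrow>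
    real \<times> real \<Rightarrow> real" where
  "phi2 \<nu> l \<mu> p =
     (2 * \<mu> p * (Du l p * \<nu> p - l p * Du \<nu> p) + l p * Du \<mu> p - Du l p * \<mu> p)
     / (2 * \<mu> p * (4 * (\<nu> p)\<^sup>2 + 4 * (l p)\<^sup>2 - 1))"

definition phi3 :: "(real \<times> real \<Rightarrow> real) \<Rightarrow> (real \<times> real \<Rightarrow> real) \<Rightarrow> (real \<times> real \<Rightarrow> real) \<Rightarrow>
    real \<times> real \<Rightarrow> real" where
  "phi3 \<nu> l \<mu> p =
     (2 * \<mu> p * (l p * Dv \<nu> p - Dv l p * \<nu> p) + l p * Dv \<mu> p - Dv l p * \<mu> p)
     / (2 * \<mu> p * (4 * (\<nu> p)\<^sup>2 + 4 * (l p)\<^sup>2 - 1))"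

definition phi4 :: "(real \<times> real \<Rightarrow> real) \<Rightarrow> (real \<times> real \<Rightarrow> real) \<Rightarrow> (real \<times> real \<Rightarrow> real) \<Rightarrow>
    real \<times> real \<Rightarrow> real" where
  "phi4 \<nu> l \<mu> p =
     - ((\<mu> p * Du (\<lambda>q. (l q)\<^sup>2 + (\<nu> q)\<^sup>2 + \<nu> q) p
         + (2 * ((l p)\<^sup>2 + (\<nu> p)\<^sup>2) - \<nu> p - 1) * Du \<mu> p)
        / (2 * \<mu> p * (4 * (\<nu> p)\<^sup>2 + 4 * (l p)\<^sup>2 - 1)))"

text \<open>The integrands \<open>\<phi>\<^sub>1 + \<phi>\<^sub>2 \<surd>G/\<surd>E\<close> and \<open>\<phi>\<^sub>3 \<surd>E/\<surd>G + \<phi>\<^sub>4\<close>.\<close>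

definition phi_12 :: "(real \<times> real \<Rightarrow> real^4) \<Rightarrow> (real \<times> real \<Rightarrow> real) \<Rightarrow>
    (real \<times> real \<Rightarrow> real) \<Rightarrow> (real \<times> real \<Rightarrow> real) \<Rightarrow> real \<times> real \<Rightarrow> real" where
  "phi_12 z \<nu> l \<mu> p = phi1 \<nu> l \<mu> p + phi2 \<nu> l \<mu> p * (sqrt (coefG z p) / sqrt (coefE z p))"

definition phi_34 :: "(real \<times> real \<Rightarrow> real^4) \<Rightarrow> (real \<times> real \<Rightarrow> real) \<Rightarrow>
    (real \<times> real \<Rightarrow> real) \<Rightarrow> (real \<times> real \<Rightarrow> real) \<Rightarrow> real \<times> real \<Rightarrow> real" where
  "phi_34 z \<nu> l \<mu> p = phi3 \<nu> l \<mu> p * (sqrt (coefE z p) / sqrt (coefG z p)) + phi4 \<nu> l \<mu> p"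

text \<open>The interval integrals below are oriented, so the upper limit may be the smaller one.\<close>

definition can_phi :: "(real \<times> real \<Rightarrow> real^4) \<Rightarrow> (real \<times> real \<Rightarrow> real) \<Rightarrow>
    (real \<times> real \<Rightarrow> real) \<Rightarrow> (real \<times> real \<Rightarrow> real) \<Rightarrow> real \<Rightarrow> real \<Rightarrow> real \<Rightarrow> real \<times> real \<Rightarrow> real" where
  "can_phi z \<nu> l \<mu> u0 v0 c1 = (\<lambda>(u, v).
     sqrt (coefE z (u, v)) *
     exp (- (LBINT s=v0..v. phi_12 z \<nu> l \<mu> (u, s))
          - (LBINT t=u0..u. phi_34 z \<nu> l \<mu> (t, v0)) + c1))"

definition can_psi :: "(real \<times> real \<Rightarrow> real^4) \<Rightarrow> (real \<times> real \<Rightarrow> real) \<Rightarrow>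
    (real \<times> real \<Rightarrow> real) \<Rightarrow> (real \<times> real \<Rightarrow> real) \<Rightarrow> real \<Rightarrow> real \<Rightarrow> real \<Rightarrow> real \<times> real \<Rightarrow> real" where
  "can_psi z \<nu> l \<mu> u0 v0 c2 = (\<lambda>(u, v).
     sqrt (coefG z (u, v)) *
     exp (- (LBINT t=u0..u. phi_34 z \<nu> l \<mu> (t, v))
          - (LBINT s=v0..v. phi_12 z \<nu> l \<mu> (u0, s)) + c2))"

text \<open>The condition \<open>4\<nu>\<^sup>2 + 4\<lambda>\<^sup>2 - 1 \<noteq> 0\<close> is what makes the four functions \<open>\<phi>\<^sub>i\<close> well defined.\<close>

definition canonical_params ::
  "(real^4) set \<Rightarrow> (real \<times> real) set \<Rightarrow> (real \<times> real \<Rightarrow> real^4) \<Rightarrow>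
   (real \<times> real \<Rightarrow> real) \<Rightarrow> (real \<times> real \<Rightarrow> real) \<Rightarrow> (real \<times> real \<Rightarrow> real) \<Rightarrow>
   real \<Rightarrow> real \<Rightarrow> real \<Rightarrow> real \<Rightarrow> bool" where
  "canonical_params M U z \<nu> l \<mu> u0 v0 c1 c2 \<longleftrightarrow>
     principal_params M U z \<nu> l \<mu> \<and>
     (\<exists>I J. open I \<and> is_interval I \<and> open J \<and> is_interval J \<and> U = I \<times> J) \<and>
     (u0, v0) \<in> U \<and>
     (\<forall>p\<in>U. 4 * (\<nu> p)\<^sup>2 + 4 * (l p)\<^sup>2 - 1 \<noteq> 0) \<and>
     (\<forall>p\<in>U. can_phi z \<nu> l \<mu> u0 v0 c1 p = 1 \<and> can_psi z \<nu> l \<mu> u0 v0 c2 p = 1)"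

end

theory Submission
  imports Defs
begin

text \<open>Write \<open>e = \<surd>E\<close>, \<open>g = \<surd>G\<close>. The \<open>n\<^sub>2\<close>-parts of the two Codazzi equations determine the normal
  connection form, and their \<open>n\<^sub>1\<close>-parts then become a linear system for \<open>e\<^sub>v\<close> and \<open>g\<^sub>u\<close> with
  determinant \<open>4 (1 - 4\<nu>\<^sup>2 - 4\<lambda>\<^sup>2) \<mu>\<^sup>2\<close>. By the equations of Gauss and Ricci, \<open>K = 2\<lambda>\<mu>\<close> and
  \<open>\<kappa> = -2\<mu>\<nu>\<close>, so this is nonzero, and Cramer's rule says that the integrands of \<open>\<phi>\<close> and \<open>\<psi>\<close> are
  \<open>(ln e)\<^sub>v\<close> and \<open>(ln g)\<^sub>u\<close>. Hence
  \<open>\<phi>(u, v) = e(u, v\<^sub>0) g(u\<^sub>0, v\<^sub>0) / g(u, v\<^sub>0) exp c\<^sub>1\<close> in every principal chart, and symmetrically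
  for \<open>\<psi>\<close>. A diagonal change of parameters \<open>u = a(s)\<close>, \<open>v = b(t)\<close> again gives principal
  parameters; it multiplies \<open>\<phi>\<close> by \<open>a'\<close> and \<open>\<psi>\<close> by \<open>b'\<close>, so it only remains to solve the autonomous
  equations \<open>a' = 1/\<phi>(a)\<close> and \<open>b' = 1/\<psi>(b)\<close>.\<close>

subsection \<open>Smooth functions of two parameters\<close>

text \<open>The two equations for a and b decouple. A diagonal change turns \<open>e\<close> and
  \<open>g\<close> into a' e and b' g; along the line v = v0 the factor b' is one constant, which
  cancels in the quotient g(u0, v0) / g(u, v0). So the equation for a does not involve b, its right
  side is known from the old chart, and the same holds with the roles exchanged. A transformation
  law for the four \<phi>_i is never computed: the new chart is again principal, so the closed form
  of the integrals applies to it directly. The exponents integrate along a horizontal and a vertical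
  segment, so the closed form needs a product of intervals. The given chart, whose domain is an
  arbitrary open set, is therefore cut down to an open box whose closure still lies in it. The
  denominator 2 \<mu> (4 \<nu>^2 + 4 \<lambda>^2 - 1) of the \<phi>_i is the determinant of the
  linear system divided by - 2 \<mu>.\<close>

lemma has_derivative_Du:
  assumes "(f has_derivative D) (at p)"
  shows "((\<lambda>s. f (s, snd p)) has_vector_derivative D (1, 0)) (at (fst p))"
proof -
  have "((\<lambda>s. (s, snd p)) has_derivative (\<lambda>h. (h, 0))) (at (fst p))"
    by (intro has_derivative_Pair has_derivative_ident has_derivative_const)
  from has_derivative_compose[OF this, of f D] assms
  have "((\<lambda>s. f (s, snd p)) has_derivative (\<lambda>h. D (h, 0))) (at (fst p))" by simp
  also have "(\<lambda>h. D (h, 0)) = (\<lambda>h. h *\<^sub>R D (1, 0))"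
    by (subst linear_cmul[OF has_derivative_linear[OF assms], symmetric]) simp
  finally show ?thesis unfolding has_vector_derivative_def .
qed

lemma has_derivative_Dv:
  assumes "(f has_derivative D) (at p)"
  shows "((\<lambda>s. f (fst p, s)) has_vector_derivative D (0, 1)) (at (snd p))"
proof -
  have "((\<lambda>s. (fst p, s)) has_derivative (\<lambda>h. (0, h))) (at (snd p))"
    by (intro has_derivative_Pair has_derivative_ident has_derivative_const)
  from has_derivative_compose[OF this, of f D] assms
  have "((\<lambda>s. f (fst p, s)) has_derivative (\<lambda>h. D (0, h))) (at (snd p))" by simp
  also have "(\<lambda>h. D (0, h)) = (\<lambda>h. h *\<^sub>R D (0, 1))"
    by (subst linear_cmul[OF has_derivative_linear[OF assms], symmetric]) simp
  finally show ?thesis unfolding has_vector_derivative_def .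
qed

lemma Du_eq: "(f has_derivative D) (at p) \<Longrightarrow> Du f p = D (1, 0)"
  unfolding Du_def by (intro vector_derivative_at has_derivative_Du)

lemma Dv_eq: "(f has_derivative D) (at p) \<Longrightarrow> Dv f p = D (0, 1)"
  unfolding Dv_def by (intro vector_derivative_at has_derivative_Dv)

lemma has_vector_derivative_Du:
  assumes "f differentiable at (u, v)"
  shows "((\<lambda>s. f (s, v)) has_vector_derivative Du f (u, v)) (at u)"
  using assms has_derivative_Du[of f _ "(u, v)"] Du_eq[of f _ "(u, v)"]
  unfolding differentiable_def by fastforce

lemma has_vector_derivative_Dv:
  assumes "f differentiable at (u, v)"
  shows "((\<lambda>t. f (u, t)) has_vector_derivative Dv f (u, v)) (at v)"
  using assms has_derivative_Dv[of f _ "(u, v)"] Dv_eq[of f _ "(u, v)"]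
  unfolding differentiable_def by fastforce

text \<open>Frame identities hold on \<open>U\<close> only, while \<open>Du\<close> differentiates a
  total function. As \<open>U\<close> is open, so is its coordinate slice through \<open>p\<close>,
  and that slice decides the derivative at \<open>p\<close>.\<close>

lemma Du_cong:
  assumes "open U" "p \<in> U" "\<And>q. q \<in> U \<Longrightarrow> f q = g q"
  shows "Du f p = Du g p"
proof -
  have "open ((\<lambda>s. (s, snd p)) -` U)"
    by (intro open_vimage continuous_intros assms)
  then have "\<forall>\<^sub>F s in nhds (fst p). s \<in> (\<lambda>s. (s, snd p)) -` U"
    by (rule eventually_nhds_in_open) (use assms in auto)
  then have "\<forall>\<^sub>F s in nhds (fst p). s \<in> UNIV \<longrightarrow> f (s, snd p) = g (s, snd p)"
    by eventually_elim (use assms in auto)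
  then show ?thesis unfolding Du_def by (intro vector_derivative_cong_eq) auto
qed

lemma Dv_cong:
  assumes "open U" "p \<in> U" "\<And>q. q \<in> U \<Longrightarrow> f q = g q"
  shows "Dv f p = Dv g p"
proof -
  have "open ((\<lambda>s. (fst p, s)) -` U)"
    by (intro open_vimage continuous_intros assms)
  then have "\<forall>\<^sub>F s in nhds (snd p). s \<in> (\<lambda>s. (fst p, s)) -` U"
    by (rule eventually_nhds_in_open) (use assms in auto)
  then have "\<forall>\<^sub>F s in nhds (snd p). s \<in> UNIV \<longrightarrow> f (fst p, s) = g (fst p, s)"
    by eventually_elim (use assms in auto)
  then show ?thesis unfolding Dv_def by (intro vector_derivative_cong_eq) auto
qed

lemma Ck_on_cong:
  assumes "open U" "\<And>q. q \<in> U \<Longrightarrow> f q = g q" "Ck_on k U f"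
  shows "Ck_on k U g"
  using assms(2,3)
proof (induction k arbitrary: f g)
  case 0 then show ?case using continuous_on_cong[of U U f g] by auto
next
  case (Suc k)
  have "g differentiable_on U"
    using Suc.prems differentiable_transform_within[OF _ zero_less_one, of f _ U g]
    by (auto simp: differentiable_on_def)
  moreover have "Ck_on k U (Du g)"
    by (rule Suc.IH[of "Du f"]) (use Suc.prems assms(1) Du_cong[of U _ f g] in auto)
  moreover have "Ck_on k U (Dv g)"
    by (rule Suc.IH[of "Dv f"]) (use Suc.prems assms(1) Dv_cong[of U _ f g] in auto)
  ultimately show ?case by simp
qed

lemma Ck_on_SucI:
  assumes "open U" "\<And>p. p \<in> U \<Longrightarrow> f differentiable at p"
    and "\<And>p. p \<in> U \<Longrightarrow> Du f p = fu p" "Ck_on k U fu"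
    and "\<And>p. p \<in> U \<Longrightarrow> Dv f p = fv p" "Ck_on k U fv"
  shows "Ck_on (Suc k) U f"
  using Ck_on_cong[OF assms(1) assms(3)[symmetric] assms(4)]
    Ck_on_cong[OF assms(1) assms(5)[symmetric] assms(6)]
  by (simp add: differentiable_on_eq_differentiable_at[OF assms(1)] assms(2))

lemma Ck_on_SucD:
  assumes "open U" "Ck_on (Suc k) U f"
  shows "p \<in> U \<Longrightarrow> f differentiable at p" "Ck_on k U (Du f)" "Ck_on k U (Dv f)"
  using assms by (auto simp: differentiable_on_eq_differentiable_at[OF assms(1)])

lemma Ck_on_Suc_imp: "Ck_on (Suc k) U f \<Longrightarrow> Ck_on k U f"
proof (induction k arbitrary: f)
  case 0 then show ?case by (simp add: differentiable_imp_continuous_on)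
next
  case (Suc k)
  have "f differentiable_on U" "Ck_on (Suc k) U (Du f)" "Ck_on (Suc k) U (Dv f)"
    using Suc.prems unfolding Ck_on.simps(2)[of "Suc k"] by blast+
  then show ?case using Suc.IH[of "Du f"] Suc.IH[of "Dv f"] unfolding Ck_on.simps(2)[of k] by blast
qed

lemma Ck_on_const: "Ck_on k U (\<lambda>p. c)"
proof (induction k arbitrary: c)
  case (Suc k)
  have "Du (\<lambda>p. c) = (\<lambda>p. 0)" "Dv (\<lambda>p. c) = (\<lambda>p. 0)" by (auto simp: fun_eq_iff Du_def Dv_def)
  with Suc show ?case by simp
qed auto

lemma Ck_on_add:
  assumes "open U" "Ck_on k U f" "Ck_on k U g"
  shows "Ck_on k U (\<lambda>p. f p + g p)"
  using assms(2,3)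
proof (induction k arbitrary: f g)
  case 0 then show ?case by (auto intro: continuous_intros)
next
  case (Suc k)
  show ?case
  proof (rule Ck_on_SucI[OF assms(1)])
    fix p assume "p \<in> U"
    then obtain F G where FG: "(f has_derivative F) (at p)" "(g has_derivative G) (at p)"
      using Ck_on_SucD(1)[OF assms(1)] Suc.prems unfolding differentiable_def by blast
    note sum = has_derivative_add[OF FG]
    show "(\<lambda>p. f p + g p) differentiable at p" using sum by (rule differentiableI)
    show "Du (\<lambda>p. f p + g p) p = Du f p + Du g p" "Dv (\<lambda>p. f p + g p) p = Dv f p + Dv g p"
      using Du_eq[OF sum] Dv_eq[OF sum] Du_eq[OF FG(1)] Du_eq[OF FG(2)] Dv_eq[OF FG(1)] Dv_eq[OF FG(2)]
      by auto
  qed (use Suc Ck_on_SucD[OF assms(1)] in auto)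
qed

lemma (in bounded_bilinear)
  assumes "f differentiable at p" "g differentiable at p"
  shows Du_bilinear: "Du (\<lambda>p. prod (f p) (g p)) p = prod (f p) (Du g p) + prod (Du f p) (g p)"
    and Dv_bilinear: "Dv (\<lambda>p. prod (f p) (g p)) p = prod (f p) (Dv g p) + prod (Dv f p) (g p)"
    and differentiable_bilinear: "(\<lambda>p. prod (f p) (g p)) differentiable at p"
proof -
  obtain F G where FG: "(f has_derivative F) (at p)" "(g has_derivative G) (at p)"
    using assms unfolding differentiable_def by blast
  note pr = FDERIV[OF FG]
  show "Du (\<lambda>p. prod (f p) (g p)) p = prod (f p) (Du g p) + prod (Du f p) (g p)"
      "Dv (\<lambda>p. prod (f p) (g p)) p = prod (f p) (Dv g p) + prod (Dv f p) (g p)"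
    using Du_eq[OF pr] Dv_eq[OF pr] Du_eq[OF FG(1)] Du_eq[OF FG(2)] Dv_eq[OF FG(1)] Dv_eq[OF FG(2)]
    by auto
  show "(\<lambda>p. prod (f p) (g p)) differentiable at p"
    using pr by (rule differentiableI)
qed

text \<open>Leibniz's rule turns both partials into sums of two such products one order lower, so
  the induction must range over all \<open>f\<close> and \<open>g\<close>. With a generic
  \<open>pr\<close> it covers real products, \<open>scaleR\<close>, \<open>inner\<close> and
  \<open>mink\<close> at once.\<close>

lemma Ck_on_bilinear:
  assumes "bounded_bilinear pr" "open U" "Ck_on k U f" "Ck_on k U g"
  shows "Ck_on k U (\<lambda>p. pr (f p) (g p))"
  using assms(3,4)
proof (induction k arbitrary: f g)
  case 0 then show ?case using bounded_bilinear.continuous_on[OF assms(1)] by auto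
next
  case (Suc k)
  note D = Ck_on_SucD[OF assms(2) Suc.prems(1)] Ck_on_SucD[OF assms(2) Suc.prems(2)]
  note k = Ck_on_Suc_imp[OF Suc.prems(1)] Ck_on_Suc_imp[OF Suc.prems(2)]
  show ?case
    by (rule Ck_on_SucI[OF assms(2)];
        (rule Ck_on_add[OF assms(2)] bounded_bilinear.Du_bilinear[OF assms(1)]
          bounded_bilinear.Dv_bilinear[OF assms(1)] bounded_bilinear.differentiable_bilinear[OF assms(1)])?;
        intro Suc.IH D k)
qed

section \<open>Closure properties of smooth functions\<close>

lemma smooth_on_differentiable:
  "smooth_on U f \<Longrightarrow> open U \<Longrightarrow> p \<in> U \<Longrightarrow> f differentiable at p"
  unfolding smooth_on_def using Ck_on_SucD(1) by blast

lemma smooth_on_continuous: "smooth_on U f \<Longrightarrow> continuous_on U f"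
  unfolding smooth_on_def using Ck_on.simps(1)[of U f] by blast

lemma smooth_on_Du: "smooth_on U f \<Longrightarrow> smooth_on U (Du f)"
  and smooth_on_Dv: "smooth_on U f \<Longrightarrow> smooth_on U (Dv f)"
  unfolding smooth_on_def using Ck_on.simps(2)[of _ U f] by blast+

lemma smooth_on_cong:
  "open U \<Longrightarrow> (\<And>q. q \<in> U \<Longrightarrow> f q = g q) \<Longrightarrow> smooth_on U f \<Longrightarrow> smooth_on U g"
  unfolding smooth_on_def using Ck_on_cong by blast

lemma smooth_on_const: "smooth_on U (\<lambda>p. c)"
  by (simp add: smooth_on_def Ck_on_const)

lemma smooth_on_add:
  "open U \<Longrightarrow> smooth_on U f \<Longrightarrow> smooth_on U g \<Longrightarrow> smooth_on U (\<lambda>p. f p + g p)"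
  by (simp add: smooth_on_def Ck_on_add)

lemma smooth_on_bilinear:
  "bounded_bilinear pr \<Longrightarrow> open U \<Longrightarrow> smooth_on U f \<Longrightarrow> smooth_on U g
    \<Longrightarrow> smooth_on U (\<lambda>p. pr (f p) (g p))"
  by (simp add: smooth_on_def Ck_on_bilinear)

lemmas smooth_on_scaleR = smooth_on_bilinear[OF bounded_bilinear_scaleR]
lemmas smooth_on_mult = smooth_on_bilinear[OF bounded_bilinear_mult]

lemma smooth_on_minus:
  assumes "open U" "smooth_on U f"
  shows "smooth_on U (\<lambda>p. - f p)"
  using smooth_on_scaleR[OF assms(1) smooth_on_const[of U "-1"] assms(2)] by simp

lemma smooth_on_diff:
  "open U \<Longrightarrow> smooth_on U f \<Longrightarrow> smooth_on U g \<Longrightarrow> smooth_on U (\<lambda>p. f p - g p)"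
  using smooth_on_add[of U f "\<lambda>p. - g p"] smooth_on_minus[of U g] by simp

lemma has_derivative_comp_real:
  fixes f :: "real \<times> real \<Rightarrow> real"
  assumes "f differentiable at p" "(h has_real_derivative c) (at (f p))"
  shows "Du (\<lambda>p. h (f p)) p = c * Du f p" "Dv (\<lambda>p. h (f p)) p = c * Dv f p"
    "(\<lambda>p. h (f p)) differentiable at p"
proof -
  obtain F where F: "(f has_derivative F) (at p)"
    using assms unfolding differentiable_def by blast
  have "((\<lambda>p. h (f p)) has_derivative (\<lambda>x. F x * c)) (at p)"
    using has_derivative_compose[OF F assms(2)[unfolded has_field_derivative_def]]
    by (simp add: mult.commute)
  from Du_eq[OF this] Dv_eq[OF this] differentiableI[OF this]
  show "Du (\<lambda>p. h (f p)) p = c * Du f p" "Dv (\<lambda>p. h (f p)) p = c * Dv f p"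
    "(\<lambda>p. h (f p)) differentiable at p"
    by (simp_all add: Du_eq[OF F] Dv_eq[OF F])
qed

text \<open>Bootstrapping: the partials of 1/f are polynomials in 1/f itself and the partials of
  \<open>f\<close>, so class k of 1/f yields class k + 1.\<close>

lemma smooth_on_inverse:
  fixes f :: "real \<times> real \<Rightarrow> real"
  assumes "open U" "smooth_on U f" "\<And>p. p \<in> U \<Longrightarrow> f p \<noteq> 0"
  shows "smooth_on U (\<lambda>p. inverse (f p))"
proof -
  have "Ck_on k U (\<lambda>p. inverse (f p))" for k
  proof (induction k)
    case 0
    then show ?case using assms smooth_on_continuous by (auto intro!: continuous_intros)
  next
    case (Suc k)
    have *: "Du (\<lambda>p. inverse (f p)) p = (-1) * ((inverse (f p) * inverse (f p)) * Du f p)"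
      "Dv (\<lambda>p. inverse (f p)) p = (-1) * ((inverse (f p) * inverse (f p)) * Dv f p)"
      "(\<lambda>p. inverse (f p)) differentiable at p" if p: "p \<in> U" for p
      using has_derivative_comp_real[OF smooth_on_differentiable[OF assms(2,1) p]
          DERIV_inverse[OF assms(3)[OF p]]] by (simp_all add: power2_eq_square)
    have D: "Ck_on k U (Du f)" "Ck_on k U (Dv f)"
      using assms(2) smooth_on_Du smooth_on_Dv unfolding smooth_on_def by blast+
    note M = Ck_on_bilinear[OF bounded_bilinear_mult assms(1)]
    have "Ck_on k U (\<lambda>p. (-1) * ((inverse (f p) * inverse (f p)) * Du f p))"
      "Ck_on k U (\<lambda>p. (-1) * ((inverse (f p) * inverse (f p)) * Dv f p))"
      by (rule M[OF Ck_on_const M[OF M[OF Suc Suc] D(1)]]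
          M[OF Ck_on_const M[OF M[OF Suc Suc] D(2)]])+
    from Ck_on_SucI[OF assms(1) *(3) *(1) this(1) *(2) this(2)] show ?case .
  qed
  then show ?thesis by (simp add: smooth_on_def)
qed

lemma smooth_on_divide:
  fixes f g :: "real \<times> real \<Rightarrow> real"
  assumes "open U" "smooth_on U f" "smooth_on U g" "\<And>p. p \<in> U \<Longrightarrow> g p \<noteq> 0"
  shows "smooth_on U (\<lambda>p. f p / g p)"
  using smooth_on_mult[OF assms(1,2) smooth_on_inverse[OF assms(1,3,4)]]
  by (simp add: divide_inverse)

lemma smooth_on_sqrt:
  fixes f :: "real \<times> real \<Rightarrow> real"
  assumes "open U" "smooth_on U f" "\<And>p. p \<in> U \<Longrightarrow> 0 < f p"
  shows "smooth_on U (\<lambda>p. sqrt (f p))"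
proof -
  have "Ck_on k U (\<lambda>p. sqrt (f p))" for k
  proof (induction k)
    case 0
    then show ?case using assms smooth_on_continuous by (auto intro!: continuous_intros)
  next
    case (Suc k)
    \<comment> \<open>The derivative is not written as 1/(2 sqrt f): in this form the factor
      \<open>sqrt (f p)\<close> is covered by the induction hypothesis and the other one by
      \<open>smooth_on_inverse\<close>.\<close>
    have *: "Du (\<lambda>p. sqrt (f p)) p = (sqrt (f p) * inverse (2 * f p)) * Du f p"
      "Dv (\<lambda>p. sqrt (f p)) p = (sqrt (f p) * inverse (2 * f p)) * Dv f p"
      "(\<lambda>p. sqrt (f p)) differentiable at p" if p: "p \<in> U" for p
    proof -
      have "inverse (sqrt (f p)) / 2 = sqrt (f p) * inverse (2 * f p)"
        using assms(3)[OF p] by (simp add: divide_simps)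
      with has_derivative_comp_real[OF smooth_on_differentiable[OF assms(2,1) p]
          DERIV_real_sqrt[OF assms(3)[OF p]]]
      show "Du (\<lambda>p. sqrt (f p)) p = (sqrt (f p) * inverse (2 * f p)) * Du f p"
        "Dv (\<lambda>p. sqrt (f p)) p = (sqrt (f p) * inverse (2 * f p)) * Dv f p"
        "(\<lambda>p. sqrt (f p)) differentiable at p" by (simp_all only:)
    qed
    have D: "Ck_on k U (Du f)" "Ck_on k U (Dv f)"
      using assms(2) smooth_on_Du smooth_on_Dv unfolding smooth_on_def by blast+
    have i: "Ck_on k U (\<lambda>p. inverse (2 * f p))"
      using smooth_on_inverse[OF assms(1) smooth_on_mult[OF assms(1) smooth_on_const assms(2)], of 2]
        assms(3) unfolding smooth_on_def by force
    note M = Ck_on_bilinear[OF bounded_bilinear_mult assms(1)]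
    have "Ck_on k U (\<lambda>p. (sqrt (f p) * inverse (2 * f p)) * Du f p)"
      "Ck_on k U (\<lambda>p. (sqrt (f p) * inverse (2 * f p)) * Dv f p)"
      by (rule M[OF M[OF Suc i] D(1)] M[OF M[OF Suc i] D(2)])+
    from Ck_on_SucI[OF assms(1) *(3) *(1) this(1) *(2) this(2)] show ?case .
  qed
  then show ?thesis by (simp add: smooth_on_def)
qed

lemma Du_mult: "f differentiable at p \<Longrightarrow> g differentiable at p \<Longrightarrow> Du (\<lambda>q. f q * g q) p = f p * Du g p + Du f p * g p"
  and Dv_mult: "f differentiable at p \<Longrightarrow> g differentiable at p \<Longrightarrow> Dv (\<lambda>q. f q * g q) p = f p * Dv g p + Dv f p * g p"
  for f g :: "real \<times> real \<Rightarrow> real"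
  by (rule bounded_bilinear.Du_bilinear[OF bounded_bilinear_mult]
      bounded_bilinear.Dv_bilinear[OF bounded_bilinear_mult]; assumption)+

lemma Du_add: "f differentiable at p \<Longrightarrow> g differentiable at p \<Longrightarrow> Du (\<lambda>q. f q + g q) p = Du f p + Du g p"
  and Dv_add: "f differentiable at p \<Longrightarrow> g differentiable at p \<Longrightarrow> Dv (\<lambda>q. f q + g q) p = Dv f p + Dv g p"
  and Du_diff: "f differentiable at p \<Longrightarrow> g differentiable at p \<Longrightarrow> Du (\<lambda>q. f q - g q) p = Du f p - Du g p"
  and Dv_diff: "f differentiable at p \<Longrightarrow> g differentiable at p \<Longrightarrow> Dv (\<lambda>q. f q - g q) p = Dv f p - Dv g p"
proof -
  assume "f differentiable at p" "g differentiable at p"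
  then obtain F G where FG: "(f has_derivative F) (at p)" "(g has_derivative G) (at p)"
    unfolding differentiable_def by blast
  show "Du (\<lambda>q. f q + g q) p = Du f p + Du g p" "Dv (\<lambda>q. f q + g q) p = Dv f p + Dv g p"
    "Du (\<lambda>q. f q - g q) p = Du f p - Du g p" "Dv (\<lambda>q. f q - g q) p = Dv f p - Dv g p"
    using Du_eq[OF has_derivative_add[OF FG]] Dv_eq[OF has_derivative_add[OF FG]]
      Du_eq[OF has_derivative_diff[OF FG]] Dv_eq[OF has_derivative_diff[OF FG]]
      Du_eq[OF FG(1)] Du_eq[OF FG(2)] Dv_eq[OF FG(1)] Dv_eq[OF FG(2)] by auto
qed

lemma Du_const [simp]: "Du (\<lambda>q. c) p = 0"
  and Dv_const [simp]: "Dv (\<lambda>q. c) p = 0"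
  by (simp_all add: Du_def Dv_def)

lemma Du_minus: "f differentiable at p \<Longrightarrow> Du (\<lambda>q. - f q) p = - Du f p"
  and Dv_minus: "f differentiable at p \<Longrightarrow> Dv (\<lambda>q. - f q) p = - Dv f p"
  using Du_diff[of "\<lambda>q. 0" p f] Dv_diff[of "\<lambda>q. 0" p f] by simp_all

text \<open>All nonzero pairings of second derivatives of \<open>z\<close> with the null normals
  have this shape, see \<open>sigma_products\<close>; the Codazzi equations differentiate
  them.\<close>

lemma Du_Dv_minus_mult3:
  fixes f g h :: "real \<times> real \<Rightarrow> real"
  assumes "open U" "smooth_on U f" "smooth_on U g" "smooth_on U h" "p \<in> U"
  shows "Du (\<lambda>q. - (f q * g q * h q)) p = - (f p * g p * Du h p + f p * Du g p * h p + Du f p * g p * h p)"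
    and "Dv (\<lambda>q. - (f q * g q * h q)) p = - (f p * g p * Dv h p + f p * Dv g p * h p + Dv f p * g p * h p)"
proof -
  note d = smooth_on_differentiable[OF _ assms(1,5)]
  note m = smooth_on_mult[OF assms(1)]
  show "Du (\<lambda>q. - (f q * g q * h q)) p = - (f p * g p * Du h p + f p * Du g p * h p + Du f p * g p * h p)"
    using Du_minus[OF d[OF m[OF m[OF assms(2,3)] assms(4)]]] Du_mult[OF d[OF m[OF assms(2,3)]] d[OF assms(4)]]
      Du_mult[OF d[OF assms(2)] d[OF assms(3)]] by (simp add: algebra_simps)
  show "Dv (\<lambda>q. - (f q * g q * h q)) p = - (f p * g p * Dv h p + f p * Dv g p * h p + Dv f p * g p * h p)"
    using Dv_minus[OF d[OF m[OF m[OF assms(2,3)] assms(4)]]] Dv_mult[OF d[OF m[OF assms(2,3)]] d[OF assms(4)]]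
      Dv_mult[OF d[OF assms(2)] d[OF assms(3)]] by (simp add: algebra_simps)
qed

lemma Ck_on_subset: "Ck_on k U f \<Longrightarrow> V \<subseteq> U \<Longrightarrow> Ck_on k V f"
  by (induction k arbitrary: f) (auto intro: continuous_on_subset differentiable_on_subset)

lemma smooth_on_subset: "smooth_on U f \<Longrightarrow> V \<subseteq> U \<Longrightarrow> smooth_on V f"
  unfolding smooth_on_def using Ck_on_subset by blast

text \<open>The second difference over a square of side \<open>h\<close> is a difference of
  differences in two ways. Two mean value steps, taken in either order of the variables, express it
  by one or the other mixed partial at a point inside the square.\<close>

lemma mixed_difference_MVT:
  fixes f :: "real \<times> real \<Rightarrow> real"
  assumes h: "0 < h"
    and d: "\<And>s t. a \<le> s \<Longrightarrow> s \<le> a + h \<Longrightarrow> b \<le> t \<Longrightarrow> t \<le> b + h \<Longrightarrow>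
      f differentiable at (s, t) \<and> Du f differentiable at (s, t) \<and> Dv f differentiable at (s, t)"
  defines "\<Delta> \<equiv> f (a + h, b + h) - f (a + h, b) - f (a, b + h) + f (a, b)"
  shows "\<exists>s t. a < s \<and> s < a + h \<and> b < t \<and> t < b + h \<and> \<Delta> = h * h * Dv (Du f) (s, t)"
    and "\<exists>s t. a < s \<and> s < a + h \<and> b < t \<and> t < b + h \<and> \<Delta> = h * h * Du (Dv f) (s, t)"
proof -
  have D: "((\<lambda>s. g (s, t)) has_real_derivative Du g (s, t)) (at s)"
    "((\<lambda>t. g (s, t)) has_real_derivative Dv g (s, t)) (at t)"
    if "g differentiable at (s, t)" for g :: "real \<times> real \<Rightarrow> real" and s t
    using has_vector_derivative_Du[OF that] has_vector_derivative_Dv[OF that]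
    by (simp_all add: has_real_derivative_iff_has_vector_derivative)
  have "\<exists>s. a < s \<and> s < a + h \<and> (f (a + h, b + h) - f (a + h, b)) - (f (a, b + h) - f (a, b))
      = (a + h - a) * (Du f (s, b + h) - Du f (s, b))"
    by (rule MVT2) (use h d in \<open>auto intro!: DERIV_diff D\<close>)
  then obtain s where s: "a < s" "s < a + h"
    "(f (a + h, b + h) - f (a + h, b)) - (f (a, b + h) - f (a, b)) = h * (Du f (s, b + h) - Du f (s, b))"
    by auto
  have "\<exists>t. b < t \<and> t < b + h \<and> Du f (s, b + h) - Du f (s, b) = (b + h - b) * Dv (Du f) (s, t)"
    by (rule MVT2) (use h s d in \<open>auto intro!: D\<close>)
  then obtain t where "b < t" "t < b + h" "Du f (s, b + h) - Du f (s, b) = h * Dv (Du f) (s, t)"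
    by auto
  with s show "\<exists>s t. a < s \<and> s < a + h \<and> b < t \<and> t < b + h \<and> \<Delta> = h * h * Dv (Du f) (s, t)"
    unfolding \<Delta>_def by (intro exI[of _ s] exI[of _ t]) auto
  have "\<exists>t. b < t \<and> t < b + h \<and> (f (a + h, b + h) - f (a, b + h)) - (f (a + h, b) - f (a, b))
      = (b + h - b) * (Dv f (a + h, t) - Dv f (a, t))"
    by (rule MVT2) (use h d in \<open>auto intro!: DERIV_diff D\<close>)
  then obtain t where t: "b < t" "t < b + h"
    "(f (a + h, b + h) - f (a, b + h)) - (f (a + h, b) - f (a, b)) = h * (Dv f (a + h, t) - Dv f (a, t))"
    by auto
  have "\<exists>s. a < s \<and> s < a + h \<and> Dv f (a + h, t) - Dv f (a, t) = (a + h - a) * Du (Dv f) (s, t)"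
    by (rule MVT2) (use h t d in \<open>auto intro!: D\<close>)
  then obtain s' where "a < s'" "s' < a + h" "Dv f (a + h, t) - Dv f (a, t) = h * Du (Dv f) (s', t)"
    by auto
  with t show "\<exists>s t. a < s \<and> s < a + h \<and> b < t \<and> t < b + h \<and> \<Delta> = h * h * Du (Dv f) (s, t)"
    unfolding \<Delta>_def by (intro exI[of _ s'] exI[of _ t]) auto
qed

lemma Du_Dv_commute_real:
  fixes f :: "real \<times> real \<Rightarrow> real"
  assumes "open U" "smooth_on U f" "p \<in> U"
  shows "Du (Dv f) p = Dv (Du f) p"
proof -
  obtain a b where p: "p = (a, b)" by (cases p)
  have c: "continuous_on U (Du (Dv f))" "continuous_on U (Dv (Du f))"
    using assms(2) by (intro smooth_on_continuous smooth_on_Du smooth_on_Dv; simp)+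
  note d = smooth_on_differentiable[OF _ assms(1)]
  have diff: "f differentiable at q" "Du f differentiable at q" "Dv f differentiable at q"
    if "q \<in> U" for q
    using d that assms(2) smooth_on_Du smooth_on_Dv by blast+
  have "\<bar>Du (Dv f) p - Dv (Du f) p\<bar> \<le> e" if "e > 0" for e
  proof -
    have "isCont (Du (Dv f)) p" "isCont (Dv (Du f)) p"
      using c assms(1,3) continuous_on_eq_continuous_at by blast+
    moreover have "0 < e / 2" using that by simp
    ultimately obtain d1 d2 where d12: "0 < d1" "0 < d2"
      "\<And>q. dist q p < d1 \<Longrightarrow> dist (Du (Dv f) q) (Du (Dv f) p) < e / 2"
      "\<And>q. dist q p < d2 \<Longrightarrow> dist (Dv (Du f) q) (Dv (Du f) p) < e / 2"
      unfolding continuous_at_eps_delta by metis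
    obtain r where r: "r > 0" "ball p r \<subseteq> U"
      using assms openE by blast
    \<comment> \<open>Points of the square of side \<open>h\<close> have distance at most 2 h from
      its corner \<open>p\<close>, hence less than 3 h; so a third of the smallest radius
      suffices.\<close>
    define h where "h = Min {d1, d2, r} / 3"
    have h: "0 < h" "3 * h \<le> d1" "3 * h \<le> d2" "3 * h \<le> r"
      using d12 r unfolding h_def by auto
    have near: "dist (s, t) p < 3 * h" if "a \<le> s" "s \<le> a + h" "b \<le> t" "t \<le> b + h" for s t
    proof -
      have "dist (s, t) p \<le> dist s a + dist t b"
        unfolding p dist_Pair_Pair by (rule sqrt_sum_squares_le_sum) auto
      also have "\<dots> < 3 * h" using that h(1) by (simp add: dist_real_def)
      finally show ?thesis .
    qed
    have inU: "(s, t) \<in> U" if "a \<le> s" "s \<le> a + h" "b \<le> t" "t \<le> b + h" for s t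
      using near[OF that] h(4) r(2) by (auto simp: dist_commute subset_iff)
    let ?D = "f (a + h, b + h) - f (a + h, b) - f (a, b + h) + f (a, b)"
    have "f differentiable at (s, t) \<and> Du f differentiable at (s, t) \<and> Dv f differentiable at (s, t)"
      if "a \<le> s" "s \<le> a + h" "b \<le> t" "t \<le> b + h" for s t
      using diff[OF inU[OF that]] by simp
    from mixed_difference_MVT[OF h(1) this]
    obtain s t s' t' where st: "a < s" "s < a + h" "b < t" "t < b + h" "?D = h * h * Dv (Du f) (s, t)"
      "a < s'" "s' < a + h" "b < t'" "t' < b + h" "?D = h * h * Du (Dv f) (s', t')"
      by blast
    then have "Dv (Du f) (s, t) = Du (Dv f) (s', t')" using h(1) by simp
    moreover have "dist (Du (Dv f) (s', t')) (Du (Dv f) p) < e / 2"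
      using near[of s' t'] st h by (intro d12) auto
    moreover have "dist (Dv (Du f) (s, t)) (Dv (Du f) p) < e / 2"
      using near[of s t] st h by (intro d12) auto
    ultimately show ?thesis by (simp add: dist_real_def abs_if split: if_splits)
  qed
  then have "\<bar>Du (Dv f) p - Dv (Du f) p\<bar> \<le> 0" using field_le_epsilon[of "\<bar>Du (Dv f) p - Dv (Du f) p\<bar>" 0] by auto
  then show ?thesis by simp
qed

lemma Du_inner: "f differentiable at p \<Longrightarrow> Du (\<lambda>q. f q \<bullet> c) p = Du f p \<bullet> c"
  and Dv_inner: "f differentiable at p \<Longrightarrow> Dv (\<lambda>q. f q \<bullet> c) p = Dv f p \<bullet> c"
  using bounded_bilinear.Du_bilinear[OF bounded_bilinear_inner, of f p "\<lambda>q. c"]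
    bounded_bilinear.Dv_bilinear[OF bounded_bilinear_inner, of f p "\<lambda>q. c"]
  by (simp_all add: Du_def[of "\<lambda>q. c"] Dv_def[of "\<lambda>q. c"])

lemma Du_Dv_commute:
  fixes f :: "real \<times> real \<Rightarrow> 'a::euclidean_space"
  assumes "open U" "smooth_on U f" "p \<in> U"
  shows "Du (Dv f) p = Dv (Du f) p"
proof (rule euclidean_eqI)
  fix b :: 'a
  note d = smooth_on_differentiable[OF _ assms(1)]
  have s: "smooth_on U (\<lambda>q. f q \<bullet> b)"
    by (rule smooth_on_bilinear[OF bounded_bilinear_inner assms(1,2) smooth_on_const])
  have "Du (Dv (\<lambda>q. f q \<bullet> b)) p = Du (\<lambda>q. Dv f q \<bullet> b) p"
    using assms(1,3) by (rule Du_cong) (rule Dv_inner, rule d, rule assms)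
  also have "\<dots> = Du (Dv f) p \<bullet> b"
    by (rule Du_inner[OF d[OF smooth_on_Dv[OF assms(2)] assms(3)]])
  moreover have "Dv (Du (\<lambda>q. f q \<bullet> b)) p = Dv (\<lambda>q. Du f q \<bullet> b) p"
    using assms(1,3) by (rule Dv_cong) (rule Du_inner, rule d, rule assms)
  moreover have "\<dots> = Dv (Du f) p \<bullet> b"
    by (rule Dv_inner[OF d[OF smooth_on_Du[OF assms(2)] assms(3)]])
  ultimately show "Du (Dv f) p \<bullet> b = Dv (Du f) p \<bullet> b"
    using Du_Dv_commute_real[OF assms(1) s assms(3)] by simp
qed

section \<open>Chain rule for maps acting on each coordinate separately\<close>

lemma product_map_derivatives:
  assumes "(a has_real_derivative da) (at (fst p))" "(b has_real_derivative db) (at (snd p))"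
    and "f differentiable at (a (fst p), b (snd p))"
  shows "Du (\<lambda>p. f (a (fst p), b (snd p))) p = da *\<^sub>R Du f (a (fst p), b (snd p))"
    and "Dv (\<lambda>p. f (a (fst p), b (snd p))) p = db *\<^sub>R Dv f (a (fst p), b (snd p))"
    and "((\<lambda>p. f (a (fst p), b (snd p))) has_derivative
      (\<lambda>h. frechet_derivative f (at (a (fst p), b (snd p))) (da * fst h, db * snd h))) (at p)"
proof -
  define F where "F = frechet_derivative f (at (a (fst p), b (snd p)))"
  have F: "(f has_derivative F) (at (a (fst p), b (snd p)))"
    using assms(3) unfolding F_def by (simp add: frechet_derivative_works)
  have "((\<lambda>p. (a (fst p), b (snd p))) has_derivative (\<lambda>h. (da * fst h, db * snd h))) (at p)"
    using has_derivative_compose[OF has_derivative_fst[OF has_derivative_ident]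
        assms(1)[unfolded has_field_derivative_def], of UNIV]
      has_derivative_compose[OF has_derivative_snd[OF has_derivative_ident]
        assms(2)[unfolded has_field_derivative_def], of UNIV]
    by (intro has_derivative_Pair) (simp_all only:)
  from has_derivative_compose[OF this, of f F] F
  have *: "((\<lambda>p. f (a (fst p), b (snd p))) has_derivative (\<lambda>h. F (da * fst h, db * snd h))) (at p)"
    by simp
  then show "((\<lambda>p. f (a (fst p), b (snd p))) has_derivative
      (\<lambda>h. frechet_derivative f (at (a (fst p), b (snd p))) (da * fst h, db * snd h))) (at p)"
    unfolding F_def .
  show "Du (\<lambda>p. f (a (fst p), b (snd p))) p = da *\<^sub>R Du f (a (fst p), b (snd p))"
    "Dv (\<lambda>p. f (a (fst p), b (snd p))) p = db *\<^sub>R Dv f (a (fst p), b (snd p))"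
  proof -
    have "F (da, 0) = da *\<^sub>R F (1, 0)" "F (0, db) = db *\<^sub>R F (0, 1)"
      by (subst linear_cmul[OF has_derivative_linear[OF F], symmetric]; simp)+
    with Du_eq[OF *] Dv_eq[OF *] Du_eq[OF F] Dv_eq[OF F]
    show "Du (\<lambda>p. f (a (fst p), b (snd p))) p = da *\<^sub>R Du f (a (fst p), b (snd p))"
      "Dv (\<lambda>p. f (a (fst p), b (snd p))) p = db *\<^sub>R Dv f (a (fst p), b (snd p))"
      by auto
  qed
qed

text \<open>The derivatives of \<open>a\<close> and \<open>b\<close> are given as functions of the target point, which keeps the
  class of functions \<open>f \<circ> (a \<times> b)\<close>, \<open>f\<close> smooth, closed under differentiation.\<close>

lemma smooth_on_product_map:
  assumes o: "open U" "open V" and s: "smooth_on V \<alpha>" "smooth_on V \<beta>" "smooth_on V f"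
    and V: "\<And>p. p \<in> U \<Longrightarrow> (a (fst p), b (snd p)) \<in> V"
    and d: "\<And>p. p \<in> U \<Longrightarrow> (a has_real_derivative \<alpha> (a (fst p), b (snd p))) (at (fst p))"
      "\<And>p. p \<in> U \<Longrightarrow> (b has_real_derivative \<beta> (a (fst p), b (snd p))) (at (snd p))"
  shows "smooth_on U (\<lambda>p. f (a (fst p), b (snd p)))"
proof -
  have "smooth_on V f \<Longrightarrow> Ck_on k U (\<lambda>p. f (a (fst p), b (snd p)))" for k and f :: "real \<times> real \<Rightarrow> 'a"
  proof (induction k arbitrary: f)
    case 0
    have "isCont (\<lambda>p. (a (fst p), b (snd p))) p" if "p \<in> U" for p
      by (intro isCont_Pair isCont_o2[OF isCont_fst[OF continuous_ident] DERIV_isCont[OF d(1)[OF that]]]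
          isCont_o2[OF isCont_snd[OF continuous_ident] DERIV_isCont[OF d(2)[OF that]]])
    then have "continuous_on U (\<lambda>p. (a (fst p), b (snd p)))"
      by (simp add: continuous_at_imp_continuous_on)
    then show ?case unfolding Ck_on.simps
      by (rule continuous_on_compose2[OF smooth_on_continuous[OF 0]]) (use V in auto)
  next
    case (Suc k)
    note sm = smooth_on_scaleR[OF o(2) s(1) smooth_on_Du[OF Suc.prems]]
      smooth_on_scaleR[OF o(2) s(2) smooth_on_Dv[OF Suc.prems]]
    show ?case
    proof (rule Ck_on_SucI[OF o(1) _ _ Suc.IH[OF sm(1)] _ Suc.IH[OF sm(2)]])
      fix p assume p: "p \<in> U"
      note pd = product_map_derivatives[OF d(1)[OF p] d(2)[OF p]
          smooth_on_differentiable[OF Suc.prems o(2) V[OF p]]]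
      show "(\<lambda>p. f (a (fst p), b (snd p))) differentiable at p"
        using pd(3) by (rule differentiableI)
      show "Du (\<lambda>p. f (a (fst p), b (snd p))) p
          = \<alpha> (a (fst p), b (snd p)) *\<^sub>R Du f (a (fst p), b (snd p))"
        "Dv (\<lambda>p. f (a (fst p), b (snd p))) p
          = \<beta> (a (fst p), b (snd p)) *\<^sub>R Dv f (a (fst p), b (snd p))"
        by (rule pd(1), rule pd(2))
    qed
  qed
  with s(3) show ?thesis by (simp add: smooth_on_def)
qed

text \<open>Freezing a coordinate is a product map with one constant factor, of derivative 0. It
  lets functions of one variable, such as the right sides of the two differential equations, be
  treated as smooth functions on the box.\<close>

lemma smooth_on_freeze_snd:
  assumes "open I" "open J" "y \<in> J" "smooth_on (I \<times> J) f"
  shows "smooth_on (I \<times> J) (\<lambda>p. f (fst p, y))"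
  by (rule smooth_on_product_map[of "I \<times> J" "I \<times> J" "\<lambda>p. 1" "\<lambda>p. 0" f "\<lambda>s. s" "\<lambda>t. y"])
    (use assms in \<open>auto simp: open_Times smooth_on_const\<close>)

lemma smooth_on_freeze_fst:
  assumes "open I" "open J" "x \<in> I" "smooth_on (I \<times> J) f"
  shows "smooth_on (I \<times> J) (\<lambda>p. f (x, snd p))"
  by (rule smooth_on_product_map[of "I \<times> J" "I \<times> J" "\<lambda>p. 0" "\<lambda>p. 1" f "\<lambda>s. x" "\<lambda>t. t"])
    (use assms in \<open>auto simp: open_Times smooth_on_const\<close>)

text \<open>Separation of variables: with \<open>P\<close> a primitive of \<open>w\<close>, the
  solution is the inverse function of \<open>P\<close>. Since \<open>w\<close> is positive,
  \<open>P\<close> is strictly increasing, so \<open>G\<close> maps an open interval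
  \<open>T\<close> homeomorphically onto the whole prescribed interval, as a change of parameters
  must.\<close>

lemma autonomous_ode_interval:
  fixes w :: "real \<Rightarrow> real"
  assumes "continuous_on {a..b} w" "\<And>x. x \<in> {a..b} \<Longrightarrow> 0 < w x"
  obtains T G P where "open T" "is_interval T" "homeomorphism T {a<..<b} G P"
    "\<And>t. t \<in> T \<Longrightarrow> (G has_real_derivative inverse (w (G t))) (at t)"
proof -
  obtain P where P': "\<And>x. x \<in> {a..b} \<Longrightarrow> (P has_vector_derivative w x) (at x within {a..b})"
    using antiderivative_continuous[OF assms(1)] by blast
  have P: "(P has_real_derivative w x) (at x)" if "x \<in> {a<..<b}" for x
    using P'[of x] that at_within_Icc_at[of a x b]
    by (simp add: has_real_derivative_iff_has_vector_derivative)
  have less: "P x < P y" if "x < y" "x \<in> {a<..<b}" "y \<in> {a<..<b}" for x y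
  proof (rule DERIV_pos_imp_increasing[OF that(1)])
    fix t assume "x \<le> t" "t \<le> y"
    then have "t \<in> {a<..<b}" using that by auto
    then show "\<exists>d. (P has_real_derivative d) (at t) \<and> 0 < d" using P assms(2)[of t] by force
  qed
  have inj: "inj_on P {a<..<b}"
    by (rule linorder_inj_onI) (use less in \<open>force+\<close>)
  have cont: "continuous_on {a<..<b} P"
    using P DERIV_isCont by (blast intro: continuous_at_imp_continuous_on)
  define T G where "T = P ` {a<..<b}" and "G = inv_into {a<..<b} P"
  have GP: "G (P x) = x" if "x \<in> {a<..<b}" for x unfolding G_def using inj that by (rule inv_into_f_f)
  have "open T" unfolding T_def by (rule injective_into_1d_imp_open_map_UNIV[OF _ cont inj]) auto
  moreover have "is_interval T"
    unfolding T_def is_interval_connected_1 by (rule connected_continuous_image[OF cont]) simp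
  moreover have deriv: "(G has_real_derivative inverse (w (G t))) (at t)" if t: "t \<in> T" for t
  proof -
    obtain x where x: "x \<in> {a<..<b}" "t = P x" using t unfolding T_def by blast
    have "w x \<noteq> 0" using assms(2)[of x] x by auto
    then have "(*) (w x) \<circ> (*) (inverse (w x)) = id" by (simp add: fun_eq_iff)
    from has_derivative_inverse_strong[OF _ x(1) cont GP P[OF x(1), unfolded has_field_derivative_def] this]
    show ?thesis using GP[OF x(1)] by (simp add: has_field_derivative_def x(2))
  qed
  moreover have "homeomorphism T {a<..<b} G P"
  proof (rule homeomorphismI)
    show "continuous_on T G" using deriv DERIV_isCont by (blast intro: continuous_at_imp_continuous_on)
  qed (use GP cont in \<open>auto simp: T_def\<close>)
  ultimately show ?thesis using that by blast
qed

lemma open_contains_box: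
  fixes U :: "(real \<times> real) set"
  assumes "open U" "(x, y) \<in> U"
  obtains a b c d where "a < x" "x < b" "c < y" "y < d" "{a..b} \<times> {c..d} \<subseteq> U"
proof -
  obtain A B where AB: "open A" "open B" "x \<in> A" "y \<in> B" "A \<times> B \<subseteq> U"
    by (rule open_prod_elim[OF assms]) auto
  obtain r where r: "0 < r" "cball x r \<subseteq> A" using AB open_contains_cball by blast
  obtain s where s: "0 < s" "cball y s \<subseteq> B" using AB open_contains_cball by blast
  show ?thesis
    by (rule that[of "x - r" "x + r" "y - s" "y + s"])
      (use r s AB(5) in \<open>auto simp: cball_eq_atLeastAtMost\<close>)
qed

lemma homeomorphism_map_prod:
  assumes "homeomorphism S T f f'" "homeomorphism S' T' g g'"
  shows "homeomorphism (S \<times> S') (T \<times> T') (\<lambda>p. (f (fst p), g (snd p))) (\<lambda>p. (f' (fst p), g' (snd p)))"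
proof (rule homeomorphismI)
  show "continuous_on (S \<times> S') (\<lambda>p. (f (fst p), g (snd p)))" "continuous_on (T \<times> T') (\<lambda>p. (f' (fst p), g' (snd p)))"
    using assms unfolding homeomorphism_def
    by (auto intro!: continuous_on_Pair intro: continuous_on_compose2[OF _ continuous_on_fst[OF continuous_on_id]]
        continuous_on_compose2[OF _ continuous_on_snd[OF continuous_on_id]])
qed (use assms in \<open>auto simp: homeomorphism_def\<close>)

subsection \<open>Null frames in Minkowski space\<close>

lemma mink_inner: "mink a b = a \<bullet> b - 2 * (a $ 4 * b $ 4)"
  by (simp add: mink_def inner_vec_def sum_4)

lemma bounded_bilinear_mink: "bounded_bilinear mink"
proof -
  \<comment> \<open>The constant is 1 + 2: by \<open>mink_inner\<close> the form differs from the
    Euclidean product by twice the product of the fourth coordinates.\<close>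
  have "\<bar>mink a b\<bar> \<le> norm a * norm b * 3" for a b
  proof -
    have "\<bar>a \<bullet> b\<bar> \<le> norm a * norm b" by (rule Cauchy_Schwarz_ineq2)
    moreover have "\<bar>a $ 4\<bar> * \<bar>b $ 4\<bar> \<le> norm a * norm b"
      by (intro mult_mono component_le_norm_cart) auto
    ultimately show ?thesis by (simp add: mink_inner abs_mult[symmetric])
  qed
  then show ?thesis
    by unfold_locales (auto simp: mink_def algebra_simps intro!: exI[of _ 3])
qed

interpretation mink: bounded_bilinear mink
  by (rule bounded_bilinear_mink)

lemma mink_commute: "mink a b = mink b a"
  by (simp add: mink_def mult.commute)

lemmas mink_simps = mink.add_left mink.add_right mink.diff_left mink.diff_right
  mink.minus_left mink.minus_right mink.scaleR_left mink.scaleR_right mink.zero_left mink.zero_right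

lemma mink_nondegenerate:
  assumes "v \<noteq> 0"
  obtains w where "mink v w \<noteq> 0"
proof -
  obtain i where "v $ i \<noteq> 0" using assms by (auto simp: vec_eq_iff)
  moreover have "mink v (axis 1 1) = v $ 1" "mink v (axis 2 1) = v $ 2"
    "mink v (axis 3 1) = v $ 3" "mink v (axis 4 1) = - v $ 4"
    by (simp_all add: mink_def axis_def)
  ultimately show ?thesis using that exhaust_4[of i] by (metis neg_equal_0_iff_equal)
qed

locale null_frame =
  fixes a b m n :: "real^4"
  assumes pos: "0 < mink a a" "0 < mink b b"
    and ab: "mink a b = 0" and mm: "mink m m = 0" and nn: "mink n n = 0" and mn: "mink m n = -1"
    and am: "mink m a = 0" and bm: "mink m b = 0" and an: "mink n a = 0" and bn: "mink n b = 0"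
begin

text \<open>\<open>T\<close> collects the pairings with the four frame vectors. Explicit preimages
  show that it is onto, so by dimension it is injective, and an equality of vectors can be tested by
  four pairings. Since <m, n> = -1, the coefficient of \<open>m\<close> is minus the pairing with
  \<open>n\<close>, and vice versa.\<close>

lemma expansion:
  "w = (mink w a / mink a a) *\<^sub>R a + (mink w b / mink b b) *\<^sub>R b - mink w n *\<^sub>R m - mink w m *\<^sub>R n"
proof -
  define c :: "4 \<Rightarrow> real^4" where "c i = (if i = 1 then a else if i = 2 then b else if i = 3 then m else n)" for i
  define T :: "real^4 \<Rightarrow> real^4" where "T w = (\<chi> i. mink w (c i))" for w
  have lin: "linear T"
    by (rule linearI) (auto simp: T_def vec_eq_iff mink_simps)
  have T: "T w = T w' \<longleftrightarrow> mink w a = mink w' a \<and> mink w b = mink w' b \<and> mink w m = mink w' m \<and> mink w n = mink w' n" for w w'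
    by (simp add: T_def vec_eq_iff forall_4 c_def)
  note orth = pos ab mm nn mn am bm an bn mink_commute[of a b] mink_commute[of a m] mink_commute[of a n]
    mink_commute[of b m] mink_commute[of b n] mink_commute[of n m]
  have "\<exists>w. x = T w" for x
    by (rule exI[of _ "(x $ 1 / mink a a) *\<^sub>R a + (x $ 2 / mink b b) *\<^sub>R b - (x $ 4) *\<^sub>R m - (x $ 3) *\<^sub>R n"])
      (use orth in \<open>simp add: T_def vec_eq_iff forall_4 c_def mink_simps\<close>)
  then have "inj T" using linear_surjective_imp_injective[OF lin] by (auto simp: surj_def)
  moreover have "T w = T ((mink w a / mink a a) *\<^sub>R a + (mink w b / mink b b) *\<^sub>R b - mink w n *\<^sub>R m - mink w m *\<^sub>R n)"
    unfolding T using orth by (simp add: mink_simps)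
  ultimately show ?thesis by (rule injD)
qed

lemma mink_expansion:
  "mink w w' = mink w a * mink w' a / mink a a + mink w b * mink w' b / mink b b
    - mink w n * mink w' m - mink w m * mink w' n"
  by (subst expansion[of w]) (simp add: mink_simps mink_commute[of _ w'])

end

section \<open>Tangent and normal planes, and the projection in orthogonal parameters\<close>

lemma tangent_plane_iff: "t \<in> tangent_plane z p \<longleftrightarrow> (\<exists>r s. t = r *\<^sub>R Du z p + s *\<^sub>R Dv z p)"
  by (simp add: tangent_plane_def span_insert span_singleton image_iff) (metis add.commute diff_add_cancel add_diff_cancel)

lemma normal_plane_iff: "n \<in> normal_plane z p \<longleftrightarrow> mink n (Du z p) = 0 \<and> mink n (Dv z p) = 0"
proof
  assume "n \<in> normal_plane z p"
  then show "mink n (Du z p) = 0 \<and> mink n (Dv z p) = 0"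
    by (simp add: normal_plane_def tangent_plane_def span_base)
qed (auto simp: normal_plane_def tangent_plane_iff mink_simps)

lemma tan_part_eq:
  assumes "coefF z p = 0" "0 < coefE z p" "0 < coefG z p"
  shows "tan_part z p w = (mink w (Du z p) / coefE z p) *\<^sub>R Du z p + (mink w (Dv z p) / coefG z p) *\<^sub>R Dv z p"
  unfolding tan_part_def
proof (rule the_equality)
  have F: "mink (Dv z p) (Du z p) = 0" using assms by (simp add: coefF_def mink_commute)
  show "(mink w (Du z p) / coefE z p) *\<^sub>R Du z p + (mink w (Dv z p) / coefG z p) *\<^sub>R Dv z p \<in> tangent_plane z p
    \<and> w - ((mink w (Du z p) / coefE z p) *\<^sub>R Du z p + (mink w (Dv z p) / coefG z p) *\<^sub>R Dv z p) \<in> normal_plane z p"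
    using assms F unfolding tangent_plane_iff normal_plane_iff
    by (auto simp: mink_simps coefE_def coefF_def coefG_def)
  fix t assume t: "t \<in> tangent_plane z p \<and> w - t \<in> normal_plane z p"
  then obtain r s where rs: "t = r *\<^sub>R Du z p + s *\<^sub>R Dv z p" unfolding tangent_plane_iff by blast
  have "mink w (Du z p) = r * coefE z p" "mink w (Dv z p) = s * coefG z p"
    using t F assms(1) unfolding normal_plane_iff rs
    by (auto simp: mink_simps coefE_def coefF_def coefG_def)
  then show "t = (mink w (Du z p) / coefE z p) *\<^sub>R Du z p + (mink w (Dv z p) / coefG z p) *\<^sub>R Dv z p"
    using rs assms by simp
qed

lemma local_param_Du_Dv_nonzero:
  assumes "local_param M U z" "p \<in> U"
  shows "Du z p \<noteq> 0" "Dv z p \<noteq> 0"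
proof -
  have "z differentiable at p"
    using assms smooth_on_differentiable unfolding local_param_def by blast
  then have F: "(z has_derivative frechet_derivative z (at p)) (at p)"
    by (simp add: frechet_derivative_works)
  have i: "inj (frechet_derivative z (at p))" using assms unfolding local_param_def by blast
  have "frechet_derivative z (at p) x \<noteq> 0" if "x \<noteq> 0" for x
    using injD[OF i, of x 0] linear_0[OF has_derivative_linear[OF F]] that by auto
  then show "Du z p \<noteq> 0" "Dv z p \<noteq> 0"
    by (simp_all add: Du_eq[OF F] Dv_eq[OF F] zero_prod_def)
qed

lemma spacelike_coef_pos:
  assumes "spacelike_surface M" "local_param M U z" "p \<in> U"
  shows "0 < coefE z p" "0 < coefG z p"
  using assms local_param_Du_Dv_nonzero[OF assms(2,3)]
  unfolding spacelike_surface_def coefE_def coefG_def tangent_plane_def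
  by (metis insertI1 insertI2 span_base)+

text \<open>A null vector in the normal plane has a unique null partner there, so that the description
  defining \<open>n\<^sub>2\<close> is proper.\<close>

lemma null_frame_n2:
  assumes "coefF z p = 0" "0 < coefE z p" "0 < coefG z p"
    and n1: "n1 z p \<in> normal_plane z p" "n1 z p \<noteq> 0" "mink (n1 z p) (n1 z p) = 0"
  shows "null_frame (Du z p) (Dv z p) (n1 z p) (n2 z p)"
proof -
  define m where "m = n1 z p"
  obtain w where w: "mink m w \<noteq> 0" using n1 mink_nondegenerate unfolding m_def by blast
  \<comment> \<open>Passing to the normal part keeps the product with \<open>m\<close>, which is
    itself normal; so \<open>m\<close> is not degenerate within the normal plane.\<close>
  define k where "k = w - tan_part z p w"
  have F: "mink (Dv z p) (Du z p) = 0" using assms by (simp add: coefF_def mink_commute)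
  have k: "mink k (Du z p) = 0" "mink k (Dv z p) = 0"
    using assms F by (simp_all add: k_def tan_part_eq mink_simps coefE_def coefF_def coefG_def)
  have m: "mink m (Du z p) = 0" "mink m (Dv z p) = 0" "mink m m = 0"
    using n1 by (auto simp: normal_plane_iff m_def)
  have "mink m k = mink m w" using assms m by (simp add: k_def tan_part_eq mink_simps)
  with w have mk: "mink m k \<noteq> 0" by simp
  \<comment> \<open>Scaling \<open>k\<close> makes the product with \<open>m\<close> equal to -1. As
    \<open>m\<close> is null, adding a multiple of it preserves this, and the multiple is the one
    that cancels <n, n>.\<close>
  define n where "n = (- 1 / mink m k) *\<^sub>R k + (mink k k / (2 * (mink m k)\<^sup>2)) *\<^sub>R m"
  have "mink m n = -1" using mk m by (simp add: n_def mink_simps)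
  moreover have "mink n n = 0" using mk m
    by (simp add: n_def mink_simps mink_commute[of k m] power2_eq_square field_simps)
  moreover have n: "mink n (Du z p) = 0" "mink n (Dv z p) = 0" using k m by (simp_all add: n_def mink_simps)
  ultimately have fr: "null_frame (Du z p) (Dv z p) m n"
    using assms m unfolding null_frame_def coefE_def coefF_def coefG_def by simp
  interpret null_frame "Du z p" "Dv z p" m n by (rule fr)
  have "n2 z p = n" unfolding n2_def m_def[symmetric]
  proof (rule the_equality)
    show "n \<in> normal_plane z p \<and> mink n n = 0 \<and> mink m n = - 1"
      using n nn mn by (simp add: normal_plane_iff)
    fix n' assume n': "n' \<in> normal_plane z p \<and> mink n' n' = 0 \<and> mink m n' = - 1"
    then have a: "mink n' (Du z p) = 0" "mink n' (Dv z p) = 0" "mink n' m = -1"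
      by (auto simp: normal_plane_iff mink_commute)
    \<comment> \<open>Uniqueness: in the frame with \<open>n\<close>, the square of
      \<open>n'\<close> is twice its pairing with \<open>n\<close>. As it vanishes, the expansion of
      \<open>n'\<close> has no \<open>m\<close>-component.\<close>
    have "0 = 2 * mink n' n" using mink_expansion[of n' n'] n' a by simp
    with expansion[of n'] a show "n' = n" by simp
  qed
  with fr show ?thesis by (simp add: m_def)
qed

subsection \<open>The equations of Gauss, Ricci and Codazzi\<close>

text \<open>The structure equations below arise by differentiating scalar products of frame fields
  whose value \<open>c\<close> is known on all of \<open>U\<close>.\<close>

lemma Du_mink_eq:
  assumes "open U" "smooth_on U f" "smooth_on U g" "\<And>q. q \<in> U \<Longrightarrow> mink (f q) (g q) = c q" "p \<in> U"
  shows "mink (f p) (Du g p) + mink (Du f p) (g p) = Du c p"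
    and "mink (f p) (Dv g p) + mink (Dv f p) (g p) = Dv c p"
proof -
  note d = smooth_on_differentiable[OF assms(2,1,5)] smooth_on_differentiable[OF assms(3,1,5)]
  show "mink (f p) (Du g p) + mink (Du f p) (g p) = Du c p"
    "mink (f p) (Dv g p) + mink (Dv f p) (g p) = Dv c p"
    using mink.Du_bilinear[OF d] mink.Dv_bilinear[OF d]
      Du_cong[OF assms(1,5), of "\<lambda>q. mink (f q) (g q)" c] Dv_cong[OF assms(1,5), of "\<lambda>q. mink (f q) (g q)" c]
      assms(4) by auto
qed

section \<open>The moving frame of a principal chart\<close>

locale principal_chart =
  fixes M :: "(real^4) set" and U z \<nu> l \<mu>
  assumes marginally_trapped: "marginally_trapped M"
    and principal: "principal_params M U z \<nu> l \<mu>"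
begin

definition e :: "real \<times> real \<Rightarrow> real" where "e p = sqrt (coefE z p)"
definition g :: "real \<times> real \<Rightarrow> real" where "g p = sqrt (coefG z p)"

lemma local_param: "local_param M U z"
  and smooth_geo: "smooth_on U \<nu>" "smooth_on U l" "smooth_on U \<mu>"
  and mu_nonzero: "p \<in> U \<Longrightarrow> \<mu> p \<noteq> 0"
  and F_zero: "p \<in> U \<Longrightarrow> coefF z p = 0"
  using principal unfolding principal_params_def by auto

lemma open_U: "open U" and smooth_z: "smooth_on U z"
  using local_param unfolding local_param_def by auto

lemma EG_pos: "p \<in> U \<Longrightarrow> 0 < coefE z p" "p \<in> U \<Longrightarrow> 0 < coefG z p"
  using marginally_trapped spacelike_coef_pos[OF _ local_param] unfolding marginally_trapped_def by blast+

lemma eg_pos: "p \<in> U \<Longrightarrow> 0 < e p" "p \<in> U \<Longrightarrow> 0 < g p"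
  by (auto simp: e_def g_def EG_pos)

lemma eg_square: "p \<in> U \<Longrightarrow> coefE z p = e p * e p" "p \<in> U \<Longrightarrow> coefG z p = g p * g p"
  using EG_pos[of p] by (auto simp: e_def g_def)

lemma smooth_frame: "smooth_on U (Du z)" "smooth_on U (Dv z)"
  by (rule smooth_on_Du smooth_on_Dv; rule smooth_z)+

lemma smooth_EG: "smooth_on U (coefE z)" "smooth_on U (coefG z)"
  unfolding coefE_def[abs_def] coefG_def[abs_def]
  by (rule smooth_on_bilinear[OF bounded_bilinear_mink open_U] smooth_frame)+

lemma smooth_eg: "smooth_on U e" "smooth_on U g"
  unfolding e_def[abs_def] g_def[abs_def]
  by (rule smooth_on_sqrt[OF open_U] smooth_EG EG_pos; assumption?)+

lemma nor_part_eq: "p \<in> U \<Longrightarrow> nor_part z p w = w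
    - ((mink w (Du z p) / coefE z p) *\<^sub>R Du z p + (mink w (Dv z p) / coefG z p) *\<^sub>R Dv z p)"
  by (simp add: nor_part_def tan_part_eq F_zero EG_pos)

lemma mink_nor_part: "p \<in> U \<Longrightarrow> n \<in> normal_plane z p \<Longrightarrow> mink (nor_part z p w) n = mink w n"
  by (simp add: nor_part_eq mink_simps normal_plane_iff mink_commute[of _ n])

lemma mink_tan_part: "p \<in> U \<Longrightarrow> mink (tan_part z p w) (Du z p) = mink w (Du z p)"
  "p \<in> U \<Longrightarrow> mink (tan_part z p w) (Dv z p) = mink w (Dv z p)"
  using F_zero[of p] EG_pos[of p]
  by (auto simp: tan_part_eq mink_simps coefE_def coefF_def coefG_def mink_commute[of "Dv z p" "Du z p"])

lemma nor_part_normal: "p \<in> U \<Longrightarrow> nor_part z p w \<in> normal_plane z p"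
  using mink_tan_part[of p w] by (simp add: normal_plane_iff nor_part_def mink_simps)

lemma nor_part_scaleR: "p \<in> U \<Longrightarrow> nor_part z p (c *\<^sub>R w) = c *\<^sub>R nor_part z p w"
  by (simp add: nor_part_eq mink_simps scaleR_right_diff_distrib scaleR_add_right)

lemma smooth_nor_part:
  assumes "smooth_on U W"
  shows "smooth_on U (\<lambda>p. nor_part z p (W p))"
proof (rule smooth_on_cong[OF open_U nor_part_eq[symmetric]])
  note q = smooth_on_divide[OF open_U smooth_on_bilinear[OF bounded_bilinear_mink open_U assms]]
  show "smooth_on U (\<lambda>p. W p - ((mink (W p) (Du z p) / coefE z p) *\<^sub>R Du z p
      + (mink (W p) (Dv z p) / coefG z p) *\<^sub>R Dv z p))"
    by (rule smooth_on_diff[OF open_U assms smooth_on_add[OF open_U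
          smooth_on_scaleR[OF open_U q[OF smooth_frame(1) smooth_EG(1)] smooth_frame(1)]
          smooth_on_scaleR[OF open_U q[OF smooth_frame(2) smooth_EG(2)] smooth_frame(2)]]])
      (use EG_pos in force)+
qed auto

lemma sigma:
  assumes "p \<in> U"
  shows "nor_part z p (Du (Du z) p) = (e p * e p * (1 + \<nu> p)) *\<^sub>R n1 z p"
    and "nor_part z p (Du (Dv z) p) = (e p * g p) *\<^sub>R (l p *\<^sub>R n1 z p + \<mu> p *\<^sub>R n2 z p)"
    and "nor_part z p (Dv (Dv z) p) = (g p * g p * (1 - \<nu> p)) *\<^sub>R n1 z p"
proof -
  have *: "sff z p (1 / e p, 0) (1 / e p, 0) = (1 + \<nu> p) *\<^sub>R n1 z p"
    "sff z p (1 / e p, 0) (0, 1 / g p) = l p *\<^sub>R n1 z p + \<mu> p *\<^sub>R n2 z p"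
    "sff z p (0, 1 / g p) (0, 1 / g p) = (1 - \<nu> p) *\<^sub>R n1 z p"
    using principal assms unfolding principal_params_def Let_def e_def g_def by auto
  then have 1: "(1 / (e p * e p)) *\<^sub>R nor_part z p (Du (Du z) p) = (1 + \<nu> p) *\<^sub>R n1 z p"
    "(1 / (e p * g p)) *\<^sub>R nor_part z p (Du (Dv z) p) = l p *\<^sub>R n1 z p + \<mu> p *\<^sub>R n2 z p"
    "(1 / (g p * g p)) *\<^sub>R nor_part z p (Dv (Dv z) p) = (1 - \<nu> p) *\<^sub>R n1 z p"
    unfolding sff_def by (simp_all add: nor_part_scaleR[OF assms])
  have r: "x = r *\<^sub>R y" if "(1 / r) *\<^sub>R x = y" "r \<noteq> 0" for r :: real and x y :: "real^4"
    using that by auto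
  have nz: "e p * e p \<noteq> 0" "e p * g p \<noteq> 0" "g p * g p \<noteq> 0" using eg_pos[OF assms] by auto
  show "nor_part z p (Du (Du z) p) = (e p * e p * (1 + \<nu> p)) *\<^sub>R n1 z p"
    "nor_part z p (Du (Dv z) p) = (e p * g p) *\<^sub>R (l p *\<^sub>R n1 z p + \<mu> p *\<^sub>R n2 z p)"
    "nor_part z p (Dv (Dv z) p) = (g p * g p * (1 - \<nu> p)) *\<^sub>R n1 z p"
    unfolding r[OF 1(1) nz(1)] r[OF 1(2) nz(2)] r[OF 1(3) nz(3)] scaleR_scaleR by (rule refl)+
qed

lemma n1_eq:
  assumes "p \<in> U"
  shows "n1 z p = (1 / (2 * (coefE z p * coefG z p))) *\<^sub>R
    (coefG z p *\<^sub>R nor_part z p (Du (Du z) p) + coefE z p *\<^sub>R nor_part z p (Dv (Dv z) p))"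
  by (simp add: n1_def mean_curv_def sff_def F_zero[OF assms])

lemma null_frame: "p \<in> U \<Longrightarrow> null_frame (Du z p) (Dv z p) (n1 z p) (n2 z p)"
proof (rule null_frame_n2)
  assume p: "p \<in> U"
  show "n1 z p \<in> normal_plane z p"
    using nor_part_normal[OF p] by (simp add: n1_eq[OF p] normal_plane_iff mink_simps)
  show "n1 z p \<noteq> 0" "mink (n1 z p) (n1 z p) = 0"
    using p marginally_trapped local_param unfolding marginally_trapped_def n1_def by blast+
qed (auto simp: F_zero EG_pos)

text \<open>\<open>n2\<close> is given by a definite description, which says nothing about
  smoothness. Solving \<sigma>(x, y) = \<lambda> n1 + \<mu> n2 for \<open>n2\<close> expresses it by
  smooth fields; this uses that \<mu> has no zeros.\<close>

lemma smooth_normals: "smooth_on U (n1 z)" "smooth_on U (n2 z)"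
proof -
  note nor = smooth_nor_part[OF smooth_on_Du[OF smooth_frame(1)]]
    smooth_nor_part[OF smooth_on_Du[OF smooth_frame(2)]] smooth_nor_part[OF smooth_on_Dv[OF smooth_frame(2)]]
  have nz: "2 * (coefE z p * coefG z p) \<noteq> 0" "\<mu> p * (e p * g p) \<noteq> 0" if "p \<in> U" for p
    using EG_pos[OF that] eg_pos[OF that] mu_nonzero[OF that] by auto
  show 1: "smooth_on U (n1 z)"
    by (rule smooth_on_cong[OF open_U n1_eq[symmetric]], assumption)
      (rule smooth_on_add[OF open_U] smooth_on_scaleR[OF open_U] smooth_on_divide[OF open_U]
        smooth_on_mult[OF open_U] smooth_on_const smooth_EG nor nz; assumption?)+
  have n2: "n2 z p = (1 / (\<mu> p * (e p * g p))) *\<^sub>R nor_part z p (Du (Dv z) p) - (l p / \<mu> p) *\<^sub>R n1 z p"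
    if "p \<in> U" for p
    using nz(2)[OF that] by (simp add: sigma[OF that] scaleR_add_right)
  show "smooth_on U (n2 z)"
    by (rule smooth_on_cong[OF open_U n2[symmetric]], assumption)
      (rule smooth_on_diff[OF open_U] smooth_on_scaleR[OF open_U] smooth_on_divide[OF open_U]
        smooth_on_mult[OF open_U] smooth_on_const smooth_geo smooth_eg nor 1 nz mu_nonzero; assumption?)+
qed

lemma frame_products:
  assumes "p \<in> U"
  shows "mink (n1 z p) (Du z p) = 0" "mink (n1 z p) (Dv z p) = 0" "mink (n2 z p) (Du z p) = 0"
    "mink (n2 z p) (Dv z p) = 0" "mink (n1 z p) (n1 z p) = 0" "mink (n2 z p) (n2 z p) = 0"
    "mink (n1 z p) (n2 z p) = -1" "mink (n2 z p) (n1 z p) = -1" "mink (Du z p) (Dv z p) = 0"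
    "mink (Du z p) (Du z p) = e p * e p" "mink (Dv z p) (Dv z p) = g p * g p"
  using null_frame[OF assms] F_zero[OF assms] eg_square[OF assms]
  unfolding null_frame_def coefE_def coefF_def coefG_def by (auto simp: mink_commute[of "n2 z p" "n1 z p"])

lemma frame_mink:
  assumes "p \<in> U"
  shows "mink w w' = mink w (Du z p) * mink w' (Du z p) / (e p * e p)
    + mink w (Dv z p) * mink w' (Dv z p) / (g p * g p)
    - mink w (n2 z p) * mink w' (n1 z p) - mink w (n1 z p) * mink w' (n2 z p)"
  using null_frame.mink_expansion[OF null_frame[OF assms], of w w'] frame_products[OF assms] by simp

lemma mixed_partials: "p \<in> U \<Longrightarrow> Dv (Du z) p = Du (Dv z) p"
  using Du_Dv_commute[OF open_U smooth_z] by simp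

text \<open>Both normals are null with product -1, so pairing with \<open>n1\<close> reads off minus
  the \<open>n2\<close>-coefficient of \<sigma>, and pairing with \<open>n2\<close> minus the
  \<open>n1\<close>-coefficient. Hence \<mu> shows up with \<open>n1\<close>, and \<nu>, \<lambda>
  with \<open>n2\<close>.\<close>

lemma sigma_products:
  assumes p: "p \<in> U"
  shows "mink (Du (Du z) p) (n1 z p) = 0" "mink (Du (Du z) p) (n2 z p) = - (e p * e p * (1 + \<nu> p))"
    "mink (Du (Dv z) p) (n1 z p) = - (e p * g p * \<mu> p)" "mink (Du (Dv z) p) (n2 z p) = - (e p * g p * l p)"
    "mink (Dv (Dv z) p) (n1 z p) = 0" "mink (Dv (Dv z) p) (n2 z p) = - (g p * g p * (1 - \<nu> p))"
proof -
  have n: "n1 z p \<in> normal_plane z p" "n2 z p \<in> normal_plane z p"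
    using frame_products[OF p] by (auto simp: normal_plane_iff)
  note fp = frame_products[OF p]
  note m = mink_nor_part[OF p n(1)] mink_nor_part[OF p n(2)]
  show "mink (Du (Du z) p) (n1 z p) = 0" "mink (Du (Du z) p) (n2 z p) = - (e p * e p * (1 + \<nu> p))"
    using m[of "Du (Du z) p"] unfolding sigma[OF p] by (simp_all add: mink_simps fp)
  show "mink (Du (Dv z) p) (n1 z p) = - (e p * g p * \<mu> p)" "mink (Du (Dv z) p) (n2 z p) = - (e p * g p * l p)"
    using m[of "Du (Dv z) p"] unfolding sigma[OF p] by (simp_all add: mink_simps fp)
  show "mink (Dv (Dv z) p) (n1 z p) = 0" "mink (Dv (Dv z) p) (n2 z p) = - (g p * g p * (1 - \<nu> p))"
    using m[of "Dv (Dv z) p"] unfolding sigma[OF p] by (simp_all add: mink_simps fp)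
qed

lemmas Du_mink = Du_mink_eq(1)[OF open_U]
lemmas Dv_mink = Du_mink_eq(2)[OF open_U]

text \<open>Weingarten's formulas, from differentiating the constant products of the frame. The only
  components left undetermined are the pairings of \<open>Du (n2 z)\<close> and
  \<open>Dv (n2 z)\<close> with \<open>n1\<close>, i.e. the normal connection form.\<close>

lemma normal_derivatives:
  assumes p: "p \<in> U"
  shows "mink (Du (n1 z) p) (Du z p) = 0" "mink (Du (n1 z) p) (Dv z p) = e p * g p * \<mu> p"
    "mink (Dv (n1 z) p) (Du z p) = e p * g p * \<mu> p" "mink (Dv (n1 z) p) (Dv z p) = 0"
    "mink (Du (n2 z) p) (Du z p) = e p * e p * (1 + \<nu> p)" "mink (Du (n2 z) p) (Dv z p) = e p * g p * l p"
    "mink (Dv (n2 z) p) (Du z p) = e p * g p * l p" "mink (Dv (n2 z) p) (Dv z p) = g p * g p * (1 - \<nu> p)"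
    "mink (Du (n1 z) p) (n1 z p) = 0" "mink (Dv (n1 z) p) (n1 z p) = 0"
    "mink (Du (n2 z) p) (n2 z p) = 0" "mink (Dv (n2 z) p) (n2 z p) = 0"
    "mink (Du (n1 z) p) (n2 z p) = - mink (Du (n2 z) p) (n1 z p)"
    "mink (Dv (n1 z) p) (n2 z p) = - mink (Dv (n2 z) p) (n1 z p)"
proof -
  note fp = frame_products and s = smooth_normals and f = smooth_frame
  note com = mink_commute[of "n1 z p" "Du (Du z) p"] mink_commute[of "n1 z p" "Du (Dv z) p"]
    mink_commute[of "n1 z p" "Dv (Dv z) p"] mink_commute[of "n2 z p" "Du (Du z) p"]
    mink_commute[of "n2 z p" "Du (Dv z) p"] mink_commute[of "n2 z p" "Dv (Dv z) p"]
  note * = sigma_products[OF p] mixed_partials[OF p] com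
  show "mink (Du (n1 z) p) (Du z p) = 0" using Du_mink[OF s(1) f(1) fp(1) p] * by simp
  show "mink (Du (n1 z) p) (Dv z p) = e p * g p * \<mu> p" using Du_mink[OF s(1) f(2) fp(2) p] * by simp
  show "mink (Dv (n1 z) p) (Du z p) = e p * g p * \<mu> p" using Dv_mink[OF s(1) f(1) fp(1) p] * by simp
  show "mink (Dv (n1 z) p) (Dv z p) = 0" using Dv_mink[OF s(1) f(2) fp(2) p] * by simp
  show "mink (Du (n2 z) p) (Du z p) = e p * e p * (1 + \<nu> p)" using Du_mink[OF s(2) f(1) fp(3) p] * by simp
  show "mink (Du (n2 z) p) (Dv z p) = e p * g p * l p" using Du_mink[OF s(2) f(2) fp(4) p] * by simp
  show "mink (Dv (n2 z) p) (Du z p) = e p * g p * l p" using Dv_mink[OF s(2) f(1) fp(3) p] * by simp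
  show "mink (Dv (n2 z) p) (Dv z p) = g p * g p * (1 - \<nu> p)" using Dv_mink[OF s(2) f(2) fp(4) p] * by simp
  show "mink (Du (n1 z) p) (n1 z p) = 0" using Du_mink[OF s(1) s(1) fp(5) p]
    by (simp add: mink_commute[of "n1 z p"])
  show "mink (Dv (n1 z) p) (n1 z p) = 0" using Dv_mink[OF s(1) s(1) fp(5) p]
    by (simp add: mink_commute[of "n1 z p"])
  show "mink (Du (n2 z) p) (n2 z p) = 0" using Du_mink[OF s(2) s(2) fp(6) p]
    by (simp add: mink_commute[of "n2 z p"])
  show "mink (Dv (n2 z) p) (n2 z p) = 0" using Dv_mink[OF s(2) s(2) fp(6) p]
    by (simp add: mink_commute[of "n2 z p"])
  show "mink (Du (n1 z) p) (n2 z p) = - mink (Du (n2 z) p) (n1 z p)" using Du_mink[OF s(1) s(2) fp(7) p]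
    by (simp add: mink_commute[of "n1 z p"])
  show "mink (Dv (n1 z) p) (n2 z p) = - mink (Dv (n2 z) p) (n1 z p)" using Dv_mink[OF s(1) s(2) fp(7) p]
    by (simp add: mink_commute[of "n1 z p"])
qed

text \<open>Gauss: each covariant derivative is the flat one minus its normal part
  (\<open>A\<close>, \<open>B\<close>). The third derivatives of \<open>z\<close> cancel by
  symmetry, and a derivative of \<open>A\<close> or \<open>B\<close> paired with z_u moves onto z_u,
  leaving products of second fundamental forms.\<close>

lemma gauss_curv:
  assumes p: "p \<in> U"
  shows "gauss_curv z p = 2 * l p * \<mu> p"
proof -
  define zvv zuv where "zvv = Dv (Dv z)" and "zuv = Du (Dv z)"
  define A B where "A q = nor_part z q (zvv q)" and "B q = nor_part z q (zuv q)" for q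
  have s: "smooth_on U zvv" "smooth_on U zuv"
    unfolding zvv_def zuv_def by (rule smooth_on_Du smooth_on_Dv smooth_frame)+
  have sAB: "smooth_on U A" "smooth_on U B"
    using smooth_nor_part[OF s(1)] smooth_nor_part[OF s(2)] by (simp_all add: A_def[abs_def] B_def[abs_def])
  have orth: "mink (A q) (Du z q) = 0" "mink (B q) (Du z q) = 0" if "q \<in> U" for q
    using nor_part_normal[OF that] by (auto simp: A_def B_def normal_plane_iff)
  have A: "A p = (g p * g p * (1 - \<nu> p)) *\<^sub>R n1 z p"
    and B: "B p = (e p * g p) *\<^sub>R (l p *\<^sub>R n1 z p + \<mu> p *\<^sub>R n2 z p)"
    using sigma[OF p] by (simp_all add: A_def B_def zvv_def zuv_def)
  have 1: "mink (Du A p) (Du z p) = 0"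
    using Du_mink[OF sAB(1) smooth_frame(1) orth(1) p] sigma_products[OF p]
    by (simp add: A mink_simps mink_commute[of "n1 z p" "Du (Du z) p"])
  have 2: "mink (Dv B p) (Du z p) = 2 * e p * g p * e p * g p * l p * \<mu> p"
    using Dv_mink[OF sAB(2) smooth_frame(1) orth(2) p] sigma_products[OF p]
    by (simp add: B mink_simps mink_commute[of "n1 z p" "Du (Dv z) p"] mink_commute[of "n2 z p" "Du (Dv z) p"]
        mixed_partials[OF p] algebra_simps)
  note d = smooth_on_differentiable[OF _ open_U p]
  have minus: "Du (\<lambda>q. zvv q - A q) p = Du zvv p - Du A p" "Dv (\<lambda>q. zuv q - B q) p = Dv zuv p - Dv B p"
    using Du_diff[OF d[OF s(1)] d[OF sAB(1)]] Dv_diff[OF d[OF s(2)] d[OF sAB(2)]] by auto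
  have 3: "Du (nabla_v z (Dv z)) p = Du zvv p - Du A p"
    unfolding minus(1)[symmetric]
    by (rule Du_cong[OF open_U p]) (simp add: nabla_v_def A_def nor_part_def zvv_def)
  have 4: "Dv (nabla_u z (Dv z)) p = Dv zuv p - Dv B p"
    unfolding minus(2)[symmetric]
    by (rule Dv_cong[OF open_U p]) (simp add: nabla_u_def B_def nor_part_def zuv_def)
  have "Du zvv p = Dv zuv p"
    unfolding zvv_def zuv_def by (rule Du_Dv_commute[OF open_U smooth_frame(2) p])
  then have "mink (nabla_u z (nabla_v z (Dv z)) p - nabla_v z (nabla_u z (Dv z)) p) (Du z p)
      = 2 * e p * g p * e p * g p * l p * \<mu> p"
    using 1 2 unfolding nabla_u_def[of z "nabla_v z (Dv z)"] nabla_v_def[of z "nabla_u z (Dv z)"]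
    by (simp add: mink_simps mink_tan_part[OF p] 3 4)
  then show ?thesis
    using eg_pos[OF p] unfolding gauss_curv_def by (simp add: F_zero[OF p] eg_square[OF p])
qed

text \<open>Ricci: \<open>n2\<close> stays null, so the normal connection maps it to a multiple of
  itself, and the curvature is the exterior derivative \<open>Du Q - Dv P\<close>; the terms
  \<open>Q * P\<close> cancel. The second derivatives of \<open>n2\<close> then cancel by symmetry,
  and the frame evaluates the remaining products of first derivatives.\<close>

lemma normal_curv:
  assumes p: "p \<in> U"
  shows "normal_curv z p = - 2 * \<mu> p * \<nu> p"
proof -
  define P Q where "P q = mink (Du (n2 z) q) (n1 z q)" and "Q q = mink (Dv (n2 z) q) (n1 z q)" for q
  note s = smooth_on_Du[OF smooth_normals(2)] smooth_on_Dv[OF smooth_normals(2)]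
  have PQ: "smooth_on U P" "smooth_on U Q" unfolding P_def[abs_def] Q_def[abs_def]
    by (rule smooth_on_bilinear[OF bounded_bilinear_mink open_U _ smooth_normals(1)], rule s)+
  have n2_conn: "nor_part z q w = - mink w (n1 z q) *\<^sub>R n2 z q" if q: "q \<in> U" "mink w (n2 z q) = 0" for q w
    using null_frame.expansion[OF null_frame[OF q(1)], of w] q(2)
    by (simp add: nor_part_eq[OF q(1)] coefE_def coefG_def algebra_simps)
  have conn: "nconn_u z (n2 z) q = (- P q) *\<^sub>R n2 z q" "nconn_v z (n2 z) q = (- Q q) *\<^sub>R n2 z q" if "q \<in> U" for q
    using n2_conn[OF that] normal_derivatives[OF that] by (simp_all add: nconn_u_def nconn_v_def P_def Q_def)
  note d = smooth_on_differentiable[OF _ open_U p]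
  have n1: "n1 z p \<in> normal_plane z p" using frame_products[OF p] by (simp add: normal_plane_iff)
  note dn2 = d[OF smooth_normals(2)] and dm = d[OF smooth_on_minus[OF open_U PQ(1)]] d[OF smooth_on_minus[OF open_U PQ(2)]]
  have "mink (nconn_u z (nconn_v z (n2 z)) p) (n1 z p) = mink (Du (\<lambda>q. (- Q q) *\<^sub>R n2 z q) p) (n1 z p)"
    unfolding nconn_u_def[of z "nconn_v z (n2 z)"] mink_nor_part[OF p n1]
    by (subst Du_cong[OF open_U p conn(2)]) auto
  also have "\<dots> = Du Q p - Q p * P p"
    unfolding bounded_bilinear.Du_bilinear[OF bounded_bilinear_scaleR dm(2) dn2] Du_minus[OF d[OF PQ(2)]]
    using frame_products[OF p] by (simp add: mink_simps P_def)
  finally have 1: "mink (nconn_u z (nconn_v z (n2 z)) p) (n1 z p) = Du Q p - Q p * P p" .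
  have "mink (nconn_v z (nconn_u z (n2 z)) p) (n1 z p) = mink (Dv (\<lambda>q. (- P q) *\<^sub>R n2 z q) p) (n1 z p)"
    unfolding nconn_v_def[of z "nconn_u z (n2 z)"] mink_nor_part[OF p n1]
    by (subst Dv_cong[OF open_U p conn(1)]) auto
  also have "\<dots> = Dv P p - Q p * P p"
    unfolding bounded_bilinear.Dv_bilinear[OF bounded_bilinear_scaleR dm(1) dn2] Dv_minus[OF d[OF PQ(1)]]
    using frame_products[OF p] by (simp add: mink_simps Q_def)
  finally have 2: "mink (nconn_v z (nconn_u z (n2 z)) p) (n1 z p) = Dv P p - Q p * P p" .
  have "Du Q p - Dv P p = mink (Dv (n2 z) p) (Du (n1 z) p) - mink (Du (n2 z) p) (Dv (n1 z) p)"
    using Du_mink[OF s(2) smooth_normals(1) Q_def[symmetric] p]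
      Dv_mink[OF s(1) smooth_normals(1) P_def[symmetric] p]
      Du_Dv_commute[OF open_U smooth_normals(2) p] by simp
  also have "\<dots> = - 2 * e p * g p * \<mu> p * \<nu> p"
    unfolding frame_mink[OF p, of "Dv (n2 z) p" "Du (n1 z) p"] frame_mink[OF p, of "Du (n2 z) p" "Dv (n1 z) p"]
    using eg_pos[OF p] by (simp add: normal_derivatives[OF p] field_simps)
  finally show ?thesis
    using eg_pos[OF p] unfolding normal_curv_def
    by (simp add: mink_simps 1 2 F_zero[OF p] real_sqrt_mult eg_square[OF p] field_simps)
qed

text \<open>The Christoffel symbols of the first kind of e^2 du^2 + g^2 dv^2, from differentiating
  the three metric coefficients.\<close>

lemma tangential_products:
  assumes p: "p \<in> U"
  shows "mink (Du (Du z) p) (Du z p) = e p * Du e p" "mink (Du (Dv z) p) (Du z p) = e p * Dv e p"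
    "mink (Du (Dv z) p) (Dv z p) = g p * Du g p" "mink (Dv (Dv z) p) (Dv z p) = g p * Dv g p"
    "mink (Du (Du z) p) (Dv z p) = - (e p * Dv e p)" "mink (Dv (Dv z) p) (Du z p) = - (g p * Du g p)"
proof -
  note f = smooth_frame and fp = frame_products
  note d = smooth_on_differentiable[OF _ open_U p]
  note com = mink_commute[of "Du z p"] mink_commute[of "Dv z p"]
  show 1: "mink (Du (Du z) p) (Du z p) = e p * Du e p"
    using Du_mink[OF f(1) f(1) fp(10) p] by (simp add: com Du_mult d smooth_eg)
  show 2: "mink (Du (Dv z) p) (Du z p) = e p * Dv e p"
    using Dv_mink[OF f(1) f(1) fp(10) p] by (simp add: com Dv_mult d smooth_eg mixed_partials[OF p])
  show 3: "mink (Du (Dv z) p) (Dv z p) = g p * Du g p"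
    using Du_mink[OF f(2) f(2) fp(11) p] by (simp add: com Du_mult d smooth_eg)
  show 4: "mink (Dv (Dv z) p) (Dv z p) = g p * Dv g p"
    using Dv_mink[OF f(2) f(2) fp(11) p] by (simp add: com Dv_mult d smooth_eg)
  show "mink (Du (Du z) p) (Dv z p) = - (e p * Dv e p)"
    using Du_mink[OF f(1) f(2) fp(9) p] mink_commute[of "Du z p" "Du (Dv z) p"] by (simp add: 2)
  show "mink (Dv (Dv z) p) (Du z p) = - (g p * Du g p)"
    using Dv_mink[OF f(1) f(2) fp(9) p] mink_commute[of "Du z p" "Dv (Dv z) p"] by (simp add: mixed_partials[OF p] 3)
qed

text \<open>Pairing with a normal field \<open>N\<close> turns Codazzi's equations into the symmetry of the third
  partial derivatives of \<open>z\<close>, and no covariant derivatives are needed.\<close>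

lemma codazzi:
  assumes p: "p \<in> U" and N: "smooth_on U N"
    and c: "\<And>q. q \<in> U \<Longrightarrow> mink (Du (Du z) q) (N q) = c11 q"
      "\<And>q. q \<in> U \<Longrightarrow> mink (Du (Dv z) q) (N q) = c12 q"
      "\<And>q. q \<in> U \<Longrightarrow> mink (Dv (Dv z) q) (N q) = c22 q"
  shows "mink (Du (Du z) p) (Dv N p) - mink (Du (Dv z) p) (Du N p) = Dv c11 p - Du c12 p"
    and "mink (Dv (Dv z) p) (Du N p) - mink (Du (Dv z) p) (Dv N p) = Du c22 p - Dv c12 p"
proof -
  note s = smooth_on_Du[OF smooth_frame(1)] smooth_on_Du[OF smooth_frame(2)] smooth_on_Dv[OF smooth_frame(2)]
  have "Dv (Du (Du z)) p = Du (Dv (Du z)) p" using Du_Dv_commute[OF open_U smooth_frame(1) p] by simp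
  also have "\<dots> = Du (Du (Dv z)) p" by (rule Du_cong[OF open_U p mixed_partials])
  finally show "mink (Du (Du z) p) (Dv N p) - mink (Du (Dv z) p) (Du N p) = Dv c11 p - Du c12 p"
    using Dv_mink[OF s(1) N c(1) p] Du_mink[OF s(2) N c(2) p] by simp
  show "mink (Dv (Dv z) p) (Du N p) - mink (Du (Dv z) p) (Dv N p) = Du c22 p - Dv c12 p"
    using Du_Dv_commute[OF open_U smooth_frame(2) p] Du_mink[OF s(3) N c(3) p] Dv_mink[OF s(2) N c(2) p]
    by simp
qed

text \<open>With \<open>N\<close> = \<open>n1\<close> two of the three pairings vanish identically
  and the third involves only \<mu>. Each equation then contains just one component of the normal
  connection form, multiplied by \<mu>.\<close>

lemma codazzi_n1:
  assumes p: "p \<in> U"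
  shows "mink (Du (n2 z) p) (n1 z p) * (g p * \<mu> p) = 2 * Du g p * \<mu> p + g p * Du \<mu> p"
    and "mink (Dv (n2 z) p) (n1 z p) * (e p * \<mu> p) = 2 * Dv e p * \<mu> p + e p * Dv \<mu> p"
proof -
  note c = codazzi[OF p smooth_normals(1) sigma_products(1,3,5)]
  note D = Du_Dv_minus_mult3[OF open_U smooth_eg smooth_geo(3) p]
  have eg: "e p \<noteq> 0" "g p \<noteq> 0" using eg_pos[OF p] by auto
  have f: "mink (Du (Du z) p) (Dv (n1 z) p) = Du e p * g p * \<mu> p"
    "mink (Du (Dv z) p) (Du (n1 z) p)
      = Du g p * e p * \<mu> p - e p * g p * \<mu> p * mink (Du (n2 z) p) (n1 z p)"
    "mink (Dv (Dv z) p) (Du (n1 z) p) = Dv g p * e p * \<mu> p"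
    "mink (Du (Dv z) p) (Dv (n1 z) p)
      = Dv e p * g p * \<mu> p - e p * g p * \<mu> p * mink (Dv (n2 z) p) (n1 z p)"
    unfolding frame_mink[OF p, of "Du (Du z) p" "Dv (n1 z) p"] frame_mink[OF p, of "Du (Dv z) p" "Du (n1 z) p"]
      frame_mink[OF p, of "Dv (Dv z) p" "Du (n1 z) p"] frame_mink[OF p, of "Du (Dv z) p" "Dv (n1 z) p"]
      tangential_products[OF p] sigma_products[OF p] normal_derivatives[OF p]
    using eg by (simp_all add: field_simps)
  \<comment> \<open>Codazzi's equation carries a common factor \<open>e p\<close> here, and
    \<open>g p\<close> in the second case; it is cancelled after the polynomial identity is
    checked.\<close>
  have "e p * (mink (Du (n2 z) p) (n1 z p) * (g p * \<mu> p)) = e p * (2 * Du g p * \<mu> p + g p * Du \<mu> p)"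
    using c(1) unfolding f D Dv_const by algebra
  then show "mink (Du (n2 z) p) (n1 z p) * (g p * \<mu> p) = 2 * Du g p * \<mu> p + g p * Du \<mu> p"
    unfolding mult_left_cancel[OF eg(1)] .
  have "g p * (mink (Dv (n2 z) p) (n1 z p) * (e p * \<mu> p)) = g p * (2 * Dv e p * \<mu> p + e p * Dv \<mu> p)"
    using c(2) unfolding f D Du_const by algebra
  then show "mink (Dv (n2 z) p) (n1 z p) * (e p * \<mu> p) = 2 * Dv e p * \<mu> p + e p * Dv \<mu> p"
    unfolding mult_left_cancel[OF eg(2)] .
qed

text \<open>Pairing with \<open>n2\<close> brings in \<nu> and \<lambda>. The derivatives
  \<open>Du e\<close> and \<open>Dv g\<close> cancel, and multiplying by \<mu> allows the connection
  form to be replaced through \<open>codazzi_n1\<close>; what remains is the linear system for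
  \<open>Dv e\<close> and \<open>Du g\<close>.\<close>

lemma codazzi_n2:
  assumes p: "p \<in> U"
  shows "(2 + 4 * \<nu> p) * Dv e p * \<mu> p - 4 * l p * Du g p * \<mu> p
      = - e p * Dv \<nu> p * \<mu> p - (1 + \<nu> p) * e p * Dv \<mu> p + g p * (Du l p * \<mu> p + l p * Du \<mu> p)"
    and "(2 - 4 * \<nu> p) * Du g p * \<mu> p - 4 * l p * Dv e p * \<mu> p
      = g p * Du \<nu> p * \<mu> p - (1 - \<nu> p) * g p * Du \<mu> p + e p * (Dv l p * \<mu> p + l p * Dv \<mu> p)"
proof -
  note c = codazzi[OF p smooth_normals(2) sigma_products(2,4,6)]
  note d = smooth_on_differentiable[OF _ open_U p]
  have s: "smooth_on U (\<lambda>q. 1 + \<nu> q)" "smooth_on U (\<lambda>q. 1 - \<nu> q)"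
    by (rule smooth_on_add[OF open_U smooth_on_const smooth_geo(1)]
        smooth_on_diff[OF open_U smooth_on_const smooth_geo(1)])+
  have D1: "Du (\<lambda>q. 1 + \<nu> q) p = Du \<nu> p" "Dv (\<lambda>q. 1 + \<nu> q) p = Dv \<nu> p"
    "Du (\<lambda>q. 1 - \<nu> q) p = - Du \<nu> p" "Dv (\<lambda>q. 1 - \<nu> q) p = - Dv \<nu> p"
    using Du_add[OF d[OF smooth_on_const[of U 1]] d[OF smooth_geo(1)]]
      Dv_add[OF d[OF smooth_on_const[of U 1]] d[OF smooth_geo(1)]]
      Du_diff[OF d[OF smooth_on_const[of U 1]] d[OF smooth_geo(1)]]
      Dv_diff[OF d[OF smooth_on_const[of U 1]] d[OF smooth_geo(1)]] by simp_all
  note D = D1 Du_Dv_minus_mult3(2)[OF open_U smooth_eg(1,1) s(1) p] Du_Dv_minus_mult3[OF open_U smooth_eg(1,2) smooth_geo(2) p]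
    Du_Dv_minus_mult3(1)[OF open_U smooth_eg(2,2) s(2) p]
  note t = tangential_products[OF p] sigma_products[OF p] normal_derivatives[OF p]
  have eg: "e p \<noteq> 0" "g p \<noteq> 0" using eg_pos[OF p] by auto
  define P Q where "P = mink (Du (n2 z) p) (n1 z p)" and "Q = mink (Dv (n2 z) p) (n1 z p)"
  note PQ = codazzi_n1[OF p, folded P_def Q_def]
  have f: "mink (Du (Du z) p) (Dv (n2 z) p)
      = Du e p * g p * l p - e p * Dv e p * (1 - \<nu> p) + e p * e p * (1 + \<nu> p) * Q"
    "mink (Du (Dv z) p) (Du (n2 z) p)
      = e p * Dv e p * (1 + \<nu> p) + Du g p * e p * l p + e p * g p * l p * P"
    "mink (Dv (Dv z) p) (Du (n2 z) p)
      = Dv g p * e p * l p - g p * Du g p * (1 + \<nu> p) + g p * g p * (1 - \<nu> p) * P"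
    "mink (Du (Dv z) p) (Dv (n2 z) p)
      = g p * Du g p * (1 - \<nu> p) + Dv e p * g p * l p + e p * g p * l p * Q"
    unfolding frame_mink[OF p, of "Du (Du z) p" "Dv (n2 z) p"] frame_mink[OF p, of "Du (Dv z) p" "Du (n2 z) p"]
      frame_mink[OF p, of "Dv (Dv z) p" "Du (n2 z) p"] frame_mink[OF p, of "Du (Dv z) p" "Dv (n2 z) p"] t
      P_def[symmetric] Q_def[symmetric]
    using eg by (simp_all add: field_simps)
  have "e p * (- Dv e p * (1 - \<nu> p) + 2 * Dv e p * (1 + \<nu> p) - Dv e p * (1 + \<nu> p) + e p * Dv \<nu> p
      + e p * (1 + \<nu> p) * Q - 2 * Du g p * l p - g p * Du l p - g p * l p * P) = e p * 0"
    using c(1) unfolding f D by algebra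
  then have 1: "2 * \<nu> p * Dv e p + e p * Dv \<nu> p + (1 + \<nu> p) * (e p * Q) - 2 * Du g p * l p
      - g p * Du l p - l p * (g p * P) = 0"
    unfolding mult_left_cancel[OF eg(1)] by algebra
  have "g p * (- Du g p * (1 + \<nu> p) + 2 * Du g p * (1 - \<nu> p) - Du g p * (1 - \<nu> p) - g p * Du \<nu> p
      + g p * (1 - \<nu> p) * P - 2 * Dv e p * l p - e p * Dv l p - e p * l p * Q) = g p * 0"
    using c(2) unfolding f D by algebra
  then have 2: "- 2 * \<nu> p * Du g p - g p * Du \<nu> p + (1 - \<nu> p) * (g p * P) - 2 * Dv e p * l p
      - e p * Dv l p - l p * (e p * Q) = 0"
    unfolding mult_left_cancel[OF eg(2)] by algebra
  have PQ': "(g p * P) * \<mu> p = 2 * Du g p * \<mu> p + g p * Du \<mu> p"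
    "(e p * Q) * \<mu> p = 2 * Dv e p * \<mu> p + e p * Dv \<mu> p"
    using PQ by (simp_all add: algebra_simps)
  show "(2 + 4 * \<nu> p) * Dv e p * \<mu> p - 4 * l p * Du g p * \<mu> p
      = - e p * Dv \<nu> p * \<mu> p - (1 + \<nu> p) * e p * Dv \<mu> p + g p * (Du l p * \<mu> p + l p * Du \<mu> p)"
    using 1 PQ' by algebra
  show "(2 - 4 * \<nu> p) * Du g p * \<mu> p - 4 * l p * Dv e p * \<mu> p
      = g p * Du \<nu> p * \<mu> p - (1 - \<nu> p) * g p * Du \<mu> p + e p * (Dv l p * \<mu> p + l p * Dv \<mu> p)"
    using 2 PQ' by algebra
qed

lemma log_derivatives:
  assumes p: "p \<in> U" and \<Delta>: "4 * (\<nu> p)\<^sup>2 + 4 * (l p)\<^sup>2 - 1 \<noteq> 0"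
  shows "phi_12 z \<nu> l \<mu> p = Dv e p / e p" and "phi_34 z \<nu> l \<mu> p = Du g p / g p"
proof -
  note d = smooth_on_differentiable[OF _ open_U p]
  note m = smooth_on_mult[OF open_U]
  note dm = d[OF m[OF smooth_geo(2) smooth_geo(2)]] d[OF m[OF smooth_geo(1) smooth_geo(1)]]
    d[OF smooth_geo(1)] d[OF smooth_geo(2)]
  note da = d[OF smooth_on_add[OF open_U m[OF smooth_geo(2) smooth_geo(2)] m[OF smooth_geo(1) smooth_geo(1)]]]
  have D: "Dv (\<lambda>q. (l q)\<^sup>2 + (\<nu> q)\<^sup>2 - \<nu> q) p = 2 * l p * Dv l p + 2 * \<nu> p * Dv \<nu> p - Dv \<nu> p"
    "Du (\<lambda>q. (l q)\<^sup>2 + (\<nu> q)\<^sup>2 + \<nu> q) p = 2 * l p * Du l p + 2 * \<nu> p * Du \<nu> p + Du \<nu> p"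
    unfolding power2_eq_square Dv_diff[OF da dm(3)] Du_add[OF da dm(3)] Dv_add[OF dm(1,2)] Du_add[OF dm(1,2)]
      Dv_mult[OF dm(3,3)] Dv_mult[OF dm(4,4)] Du_mult[OF dm(3,3)] Du_mult[OF dm(4,4)]
    by simp_all
  have eg: "e p \<noteq> 0" "g p \<noteq> 0" using eg_pos[OF p] by auto
  define \<Delta>' where "\<Delta>' = 2 * \<mu> p * (4 * (\<nu> p)\<^sup>2 + 4 * (l p)\<^sup>2 - 1)"
  have \<Delta>': "\<Delta>' \<noteq> 0" using \<Delta> mu_nonzero[OF p] by (simp add: \<Delta>'_def)
  note c = codazzi_n2[OF p]
  \<comment> \<open>Numerators over the common denominator \<open>\<Delta>'\<close>: the four
    functions \<phi>_i are - X, Y, V, - W divided by it.\<close>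
  define X Y where "X = \<mu> p * (2 * l p * Dv l p + 2 * \<nu> p * Dv \<nu> p - Dv \<nu> p)
      + (2 * ((l p)\<^sup>2 + (\<nu> p)\<^sup>2) + \<nu> p - 1) * Dv \<mu> p"
    and "Y = 2 * \<mu> p * (Du l p * \<nu> p - l p * Du \<nu> p) + l p * Du \<mu> p - Du l p * \<mu> p"
  define V W where "V = 2 * \<mu> p * (l p * Dv \<nu> p - Dv l p * \<nu> p) + l p * Dv \<mu> p - Dv l p * \<mu> p"
    and "W = \<mu> p * (2 * l p * Du l p + 2 * \<nu> p * Du \<nu> p + Du \<nu> p)
      + (2 * ((l p)\<^sup>2 + (\<nu> p)\<^sup>2) - \<nu> p - 1) * Du \<mu> p"
  have "Dv e p * \<Delta>' = - X * e p + Y * g p"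
  proof -
    \<comment> \<open>Eliminating \<open>Du g\<close> with the coefficients 2 - 4 \<nu> and 4
      \<lambda> leaves - 2 \<open>\<Delta>'\<close> in front of \<open>Dv e\<close>; hence the
      factor 2.\<close>
    have "2 * (Dv e p * \<Delta>') = 2 * (- X * e p + Y * g p)"
      unfolding \<Delta>'_def X_def Y_def using c by algebra
    then show ?thesis by simp
  qed
  then have "Dv e p / e p = - (X / \<Delta>') + Y / \<Delta>' * (g p / e p)" using eg \<Delta>' by (simp add: field_simps)
  then show "phi_12 z \<nu> l \<mu> p = Dv e p / e p"
    unfolding phi_12_def phi1_def phi2_def D X_def Y_def \<Delta>'_def e_def[symmetric] g_def[symmetric] by simp
  have "Du g p * \<Delta>' = V * e p - W * g p"
  proof -
    have "2 * (Du g p * \<Delta>') = 2 * (V * e p - W * g p)"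
      unfolding \<Delta>'_def V_def W_def using c by algebra
    then show ?thesis by simp
  qed
  then have "Du g p / g p = V / \<Delta>' * (e p / g p) + - (W / \<Delta>')" using eg \<Delta>' by (simp add: field_simps)
  then show "phi_34 z \<nu> l \<mu> p = Du g p / g p"
    unfolding phi_34_def phi3_def phi4_def D V_def W_def \<Delta>'_def e_def[symmetric] g_def[symmetric] by simp
qed

text \<open>By the fundamental theorem the first exponent of \<open>can_phi\<close> contributes e(u,
  v0) / e(u, v), which cancels the prefactor; so the result no longer depends on v. The interval
  hypotheses keep both paths of integration inside \<open>U\<close>.\<close>

lemma canonical_integrals:
  assumes U: "U = I \<times> J" "is_interval I" "is_interval J" and base: "(u0, v0) \<in> U" and p: "(u, v) \<in> U"
    and \<Delta>: "\<And>p. p \<in> U \<Longrightarrow> 4 * (\<nu> p)\<^sup>2 + 4 * (l p)\<^sup>2 - 1 \<noteq> 0"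
  shows "can_phi z \<nu> l \<mu> u0 v0 c1 (u, v) = e (u, v0) * g (u0, v0) / g (u, v0) * exp c1"
    and "can_psi z \<nu> l \<mu> u0 v0 c2 (u, v) = g (u0, v) * e (u0, v0) / e (u0, v) * exp c2"
proof -
  \<comment> \<open>The limits of an oriented integral may come in either order.\<close>
  have seg: "{min x y..max x y} \<subseteq> S" if "is_interval S" "x \<in> S" "y \<in> S" for S :: "real set" and x y
  proof
    fix t assume "t \<in> {min x y..max x y}"
    then have "x \<le> t \<and> t \<le> y \<or> y \<le> t \<and> t \<le> x" by (auto simp: min_def max_def split: if_splits)
    then show "t \<in> S" using that unfolding is_interval_1 by blast
  qed
  have deriv: "((\<lambda>t. ln (e (x, t))) has_real_derivative phi_12 z \<nu> l \<mu> (x, y)) (at y)"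
    "((\<lambda>s. ln (g (s, y))) has_real_derivative phi_34 z \<nu> l \<mu> (x, y)) (at x)" if xy: "(x, y) \<in> U" for x y
  proof -
    have "((\<lambda>t. e (x, t)) has_real_derivative Dv e (x, y)) (at y)"
      "((\<lambda>s. g (s, y)) has_real_derivative Du g (x, y)) (at x)"
      using has_vector_derivative_Dv[OF smooth_on_differentiable[OF smooth_eg(1) open_U xy]]
        has_vector_derivative_Du[OF smooth_on_differentiable[OF smooth_eg(2) open_U xy]]
      by (simp_all add: has_real_derivative_iff_has_vector_derivative)
    from DERIV_chain2[where f = ln, OF DERIV_ln_divide[OF eg_pos(1)[OF xy]] this(1)]
      DERIV_chain2[where f = ln, OF DERIV_ln_divide[OF eg_pos(2)[OF xy]] this(2)]
    show "((\<lambda>t. ln (e (x, t))) has_real_derivative phi_12 z \<nu> l \<mu> (x, y)) (at y)"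
      "((\<lambda>s. ln (g (s, y))) has_real_derivative phi_34 z \<nu> l \<mu> (x, y)) (at x)"
      unfolding log_derivatives[OF xy \<Delta>[OF xy]] by simp_all
  qed
  have "smooth_on U (\<lambda>p. Dv e p / e p)" "smooth_on U (\<lambda>p. Du g p / g p)"
    by (rule smooth_on_divide[OF open_U smooth_on_Dv[OF smooth_eg(1)] smooth_eg(1)]
        smooth_on_divide[OF open_U smooth_on_Du[OF smooth_eg(2)] smooth_eg(2)], use eg_pos in force)+
  note sm = this
  have cont: "continuous_on U (phi_12 z \<nu> l \<mu>)" "continuous_on U (phi_34 z \<nu> l \<mu>)"
    using log_derivatives \<Delta> continuous_on_eq[OF smooth_on_continuous[OF sm(1)], of "phi_12 z \<nu> l \<mu>"]
      continuous_on_eq[OF smooth_on_continuous[OF sm(2)], of "phi_34 z \<nu> l \<mu>"]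
    by auto
  have int12: "(LBINT s=v0..y. phi_12 z \<nu> l \<mu> (x, s)) = ln (e (x, y)) - ln (e (x, v0))"
    if "x \<in> I" "y \<in> J" for x y
  proof (rule interval_integral_FTC_finite)
    have J: "{min v0 y..max v0 y} \<subseteq> J" using seg[OF U(3)] base that U(1) by auto
    show "continuous_on {min v0 y..max v0 y} (\<lambda>s. phi_12 z \<nu> l \<mu> (x, s))"
      by (rule continuous_on_compose2[OF cont(1)]) (use J that U(1) in \<open>auto intro!: continuous_intros\<close>)
    fix t assume "min v0 y \<le> t" "t \<le> max v0 y"
    then have "(x, t) \<in> U" using J that U(1) by auto
    from deriv(1)[OF this]
    show "((\<lambda>t. ln (e (x, t))) has_vector_derivative phi_12 z \<nu> l \<mu> (x, t)) (at t within {min v0 y..max v0 y})"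
      unfolding has_real_derivative_iff_has_vector_derivative
      by (rule has_vector_derivative_at_within)
  qed
  have int34: "(LBINT t=u0..x. phi_34 z \<nu> l \<mu> (t, y)) = ln (g (x, y)) - ln (g (u0, y))"
    if "x \<in> I" "y \<in> J" for x y
  proof (rule interval_integral_FTC_finite)
    have I: "{min u0 x..max u0 x} \<subseteq> I" using seg[OF U(2)] base that U(1) by auto
    show "continuous_on {min u0 x..max u0 x} (\<lambda>t. phi_34 z \<nu> l \<mu> (t, y))"
      by (rule continuous_on_compose2[OF cont(2)]) (use I that U(1) in \<open>auto intro!: continuous_intros\<close>)
    fix t assume "min u0 x \<le> t" "t \<le> max u0 x"
    then have "(t, y) \<in> U" using I that U(1) by auto
    from deriv(2)[OF this]
    show "((\<lambda>s. ln (g (s, y))) has_vector_derivative phi_34 z \<nu> l \<mu> (t, y)) (at t within {min u0 x..max u0 x})"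
      unfolding has_real_derivative_iff_has_vector_derivative
      by (rule has_vector_derivative_at_within)
  qed
  have IJ: "u \<in> I" "v \<in> J" "u0 \<in> I" "v0 \<in> J" using p base U(1) by auto
  have pos: "0 < e (x, y)" "0 < g (x, y)" if "x \<in> I" "y \<in> J" for x y using eg_pos that U(1) by auto
  show "can_phi z \<nu> l \<mu> u0 v0 c1 (u, v) = e (u, v0) * g (u0, v0) / g (u, v0) * exp c1"
    unfolding can_phi_def case_prod_conv int12[OF IJ(1,2)] int34[OF IJ(1,4)] e_def[symmetric]
    using pos[OF IJ(1,2)] pos[OF IJ(1,4)] pos[OF IJ(3,4)]
    by (simp add: exp_add exp_diff)
  show "can_psi z \<nu> l \<mu> u0 v0 c2 (u, v) = g (u0, v) * e (u0, v0) / e (u0, v) * exp c2"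
    unfolding can_psi_def case_prod_conv int34[OF IJ(1,2)] int12[OF IJ(3,2)] g_def[symmetric]
    using pos[OF IJ(1,2)] pos[OF IJ(3,2)] pos[OF IJ(3,4)]
    by (simp add: exp_add exp_diff)
qed

end

subsection \<open>Diagonal changes of principal parameters\<close>

text \<open>A diagonal change of parameters \<open>\<Phi> = a \<times> b\<close>; its derivatives \<open>\<alpha>\<close>, \<open>\<beta>\<close> are functions of
  the old parameters.\<close>

locale diagonal_change = principal_chart +
  fixes V W :: "(real \<times> real) set" and a b :: "real \<Rightarrow> real" and \<alpha> \<beta> :: "real \<times> real \<Rightarrow> real" and \<Psi> \<Phi>
  defines "\<Phi> \<equiv> \<lambda>p. (a (fst p), b (snd p))"
  assumes W: "open W" and V: "open V" "V \<subseteq> U"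
    and homeo: "homeomorphism W V \<Phi> \<Psi>"
    and smooth_ab: "smooth_on V \<alpha>" "smooth_on V \<beta>"
    and pos_ab: "\<And>q. q \<in> V \<Longrightarrow> 0 < \<alpha> q" "\<And>q. q \<in> V \<Longrightarrow> 0 < \<beta> q"
    and deriv_ab: "\<And>p. p \<in> W \<Longrightarrow> (a has_real_derivative \<alpha> (\<Phi> p)) (at (fst p))"
      "\<And>p. p \<in> W \<Longrightarrow> (b has_real_derivative \<beta> (\<Phi> p)) (at (snd p))"
begin

definition z' :: "real \<times> real \<Rightarrow> real^4" where "z' p = z (\<Phi> p)"

lemma \<Phi>_in: "p \<in> W \<Longrightarrow> \<Phi> p \<in> V" "p \<in> W \<Longrightarrow> \<Phi> p \<in> U"
  using homeo V unfolding homeomorphism_def by blast+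

lemma smooth_comp: "smooth_on V f \<Longrightarrow> smooth_on W (\<lambda>p. f (\<Phi> p))"
  unfolding \<Phi>_def
  by (rule smooth_on_product_map[OF W V(1) smooth_ab])
    (use \<Phi>_in deriv_ab in \<open>simp_all add: \<Phi>_def\<close>)

lemma partials_comp:
  assumes "p \<in> W" "smooth_on V f"
  shows "Du (\<lambda>p. f (\<Phi> p)) p = \<alpha> (\<Phi> p) *\<^sub>R Du f (\<Phi> p)" "Dv (\<lambda>p. f (\<Phi> p)) p = \<beta> (\<Phi> p) *\<^sub>R Dv f (\<Phi> p)"
    "((\<lambda>p. f (\<Phi> p)) has_derivative
      (\<lambda>h. frechet_derivative f (at (\<Phi> p)) (\<alpha> (\<Phi> p) * fst h, \<beta> (\<Phi> p) * snd h))) (at p)"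
  using product_map_derivatives[OF deriv_ab(1)[OF assms(1)] deriv_ab(2)[OF assms(1)],
      OF smooth_on_differentiable[OF assms(2) V(1) \<Phi>_in(1)[OF assms(1)], unfolded \<Phi>_def]]
  unfolding \<Phi>_def by simp_all

lemma smooth_V: "smooth_on V z" "smooth_on V (Du z)" "smooth_on V (Dv z)"
  using smooth_on_subset[OF _ V(2)] smooth_z smooth_frame by blast+

lemma partials_z':
  assumes "p \<in> W"
  shows "Du z' p = \<alpha> (\<Phi> p) *\<^sub>R Du z (\<Phi> p)" "Dv z' p = \<beta> (\<Phi> p) *\<^sub>R Dv z (\<Phi> p)"
  using partials_comp[OF assms smooth_V(1)] by (simp_all add: z'_def[abs_def])

lemma second_partials_z':
  assumes p: "p \<in> W"
  shows "Du (Du z') p = (\<alpha> (\<Phi> p) * \<alpha> (\<Phi> p)) *\<^sub>R Du (Du z) (\<Phi> p) + (\<alpha> (\<Phi> p) * Du \<alpha> (\<Phi> p)) *\<^sub>R Du z (\<Phi> p)"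
    and "Du (Dv z') p = (\<alpha> (\<Phi> p) * \<beta> (\<Phi> p)) *\<^sub>R Du (Dv z) (\<Phi> p) + (\<alpha> (\<Phi> p) * Du \<beta> (\<Phi> p)) *\<^sub>R Dv z (\<Phi> p)"
    and "Dv (Dv z') p = (\<beta> (\<Phi> p) * \<beta> (\<Phi> p)) *\<^sub>R Dv (Dv z) (\<Phi> p) + (\<beta> (\<Phi> p) * Dv \<beta> (\<Phi> p)) *\<^sub>R Dv z (\<Phi> p)"
proof -
  note d = smooth_on_differentiable[OF _ V(1) \<Phi>_in(1)[OF p]]
  note bl = bounded_bilinear.Du_bilinear[OF bounded_bilinear_scaleR] bounded_bilinear.Dv_bilinear[OF bounded_bilinear_scaleR]
  note sm = smooth_on_scaleR[OF V(1)]
  have "Du (Du z') p = Du (\<lambda>p. \<alpha> (\<Phi> p) *\<^sub>R Du z (\<Phi> p)) p"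
    "Du (Dv z') p = Du (\<lambda>p. \<beta> (\<Phi> p) *\<^sub>R Dv z (\<Phi> p)) p" "Dv (Dv z') p = Dv (\<lambda>p. \<beta> (\<Phi> p) *\<^sub>R Dv z (\<Phi> p)) p"
    by (rule Du_cong[OF W p partials_z'(1)] Du_cong[OF W p partials_z'(2)] Dv_cong[OF W p partials_z'(2)]; assumption)+
  then show "Du (Du z') p = (\<alpha> (\<Phi> p) * \<alpha> (\<Phi> p)) *\<^sub>R Du (Du z) (\<Phi> p) + (\<alpha> (\<Phi> p) * Du \<alpha> (\<Phi> p)) *\<^sub>R Du z (\<Phi> p)"
    "Du (Dv z') p = (\<alpha> (\<Phi> p) * \<beta> (\<Phi> p)) *\<^sub>R Du (Dv z) (\<Phi> p) + (\<alpha> (\<Phi> p) * Du \<beta> (\<Phi> p)) *\<^sub>R Dv z (\<Phi> p)"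
    "Dv (Dv z') p = (\<beta> (\<Phi> p) * \<beta> (\<Phi> p)) *\<^sub>R Dv (Dv z) (\<Phi> p) + (\<beta> (\<Phi> p) * Dv \<beta> (\<Phi> p)) *\<^sub>R Dv z (\<Phi> p)"
    unfolding partials_comp(1)[OF p sm[OF smooth_ab(1) smooth_V(2)]] partials_comp[OF p sm[OF smooth_ab(2) smooth_V(3)]]
      bl[OF d[OF smooth_ab(1)] d[OF smooth_V(2)]] bl[OF d[OF smooth_ab(2)] d[OF smooth_V(3)]]
    by (simp_all add: scaleR_add_right)
qed

lemma planes_z':
  assumes p: "p \<in> W"
  shows "tangent_plane z' p = tangent_plane z (\<Phi> p)" "normal_plane z' p = normal_plane z (\<Phi> p)"
    "nor_part z' p w = nor_part z (\<Phi> p) w"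
proof -
  have nz: "\<alpha> (\<Phi> p) \<noteq> 0" "\<beta> (\<Phi> p) \<noteq> 0" using pos_ab[OF \<Phi>_in(1)[OF p]] by auto
  show t: "tangent_plane z' p = tangent_plane z (\<Phi> p)"
  proof (intro set_eqI iffI)
    fix t assume "t \<in> tangent_plane z' p"
    then show "t \<in> tangent_plane z (\<Phi> p)" unfolding tangent_plane_iff partials_z'[OF p] scaleR_scaleR by blast
  next
    fix t assume "t \<in> tangent_plane z (\<Phi> p)"
    then obtain r s where "t = r *\<^sub>R Du z (\<Phi> p) + s *\<^sub>R Dv z (\<Phi> p)" unfolding tangent_plane_iff by blast
    then have "t = (r / \<alpha> (\<Phi> p)) *\<^sub>R Du z' p + (s / \<beta> (\<Phi> p)) *\<^sub>R Dv z' p" using nz by (simp add: partials_z'[OF p])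
    then show "t \<in> tangent_plane z' p" unfolding tangent_plane_iff by blast
  qed
  show n: "normal_plane z' p = normal_plane z (\<Phi> p)" unfolding normal_plane_def t ..
  show "nor_part z' p w = nor_part z (\<Phi> p) w" unfolding nor_part_def tan_part_def t n ..
qed

lemma coefs_z':
  assumes p: "p \<in> W"
  shows "coefE z' p = \<alpha> (\<Phi> p) * \<alpha> (\<Phi> p) * coefE z (\<Phi> p)" "coefG z' p = \<beta> (\<Phi> p) * \<beta> (\<Phi> p) * coefG z (\<Phi> p)"
    "coefF z' p = 0"
    "sqrt (coefE z' p) = \<alpha> (\<Phi> p) * e (\<Phi> p)" "sqrt (coefG z' p) = \<beta> (\<Phi> p) * g (\<Phi> p)"
proof -
  show 1: "coefE z' p = \<alpha> (\<Phi> p) * \<alpha> (\<Phi> p) * coefE z (\<Phi> p)" "coefG z' p = \<beta> (\<Phi> p) * \<beta> (\<Phi> p) * coefG z (\<Phi> p)"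
    by (simp_all add: coefE_def coefG_def partials_z'[OF p] mink_simps)
  show "coefF z' p = 0" using F_zero[OF \<Phi>_in(2)[OF p]] by (simp add: coefF_def partials_z'[OF p] mink_simps)
  show "sqrt (coefE z' p) = \<alpha> (\<Phi> p) * e (\<Phi> p)" "sqrt (coefG z' p) = \<beta> (\<Phi> p) * g (\<Phi> p)"
    using pos_ab[OF \<Phi>_in(1)[OF p]] by (simp_all add: 1 real_sqrt_mult e_def g_def)
qed

text \<open>The second partials of \<open>z'\<close> contain derivatives of \<alpha> and \<beta>,
  but only as multiples of z_u and z_v; these are tangential and vanish in the normal part.\<close>

lemma sigma_z':
  assumes p: "p \<in> W"
  shows "nor_part z' p (Du (Du z') p) = (\<alpha> (\<Phi> p) * \<alpha> (\<Phi> p)) *\<^sub>R nor_part z (\<Phi> p) (Du (Du z) (\<Phi> p))"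
    "nor_part z' p (Du (Dv z') p) = (\<alpha> (\<Phi> p) * \<beta> (\<Phi> p)) *\<^sub>R nor_part z (\<Phi> p) (Du (Dv z) (\<Phi> p))"
    "nor_part z' p (Dv (Dv z') p) = (\<beta> (\<Phi> p) * \<beta> (\<Phi> p)) *\<^sub>R nor_part z (\<Phi> p) (Dv (Dv z) (\<Phi> p))"
    "nor_part z' p (c *\<^sub>R w) = c *\<^sub>R nor_part z' p w"
proof -
  note q = \<Phi>_in(2)[OF p]
  have t: "nor_part z (\<Phi> p) (c *\<^sub>R w + d *\<^sub>R Du z (\<Phi> p)) = c *\<^sub>R nor_part z (\<Phi> p) w"
    "nor_part z (\<Phi> p) (c *\<^sub>R w + d *\<^sub>R Dv z (\<Phi> p)) = c *\<^sub>R nor_part z (\<Phi> p) w" for c d w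
    unfolding nor_part_eq[OF q]
    using frame_products[OF q] eg_pos[OF q] eg_square[OF q] mink_commute[of "Dv z (\<Phi> p)" "Du z (\<Phi> p)"]
    by (simp_all add: mink_simps add_divide_distrib scaleR_add_left scaleR_add_right scaleR_diff_right)
  show "nor_part z' p (Du (Du z') p) = (\<alpha> (\<Phi> p) * \<alpha> (\<Phi> p)) *\<^sub>R nor_part z (\<Phi> p) (Du (Du z) (\<Phi> p))"
    "nor_part z' p (Du (Dv z') p) = (\<alpha> (\<Phi> p) * \<beta> (\<Phi> p)) *\<^sub>R nor_part z (\<Phi> p) (Du (Dv z) (\<Phi> p))"
    "nor_part z' p (Dv (Dv z') p) = (\<beta> (\<Phi> p) * \<beta> (\<Phi> p)) *\<^sub>R nor_part z (\<Phi> p) (Dv (Dv z) (\<Phi> p))"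
    unfolding planes_z'[OF p] second_partials_z'[OF p] t by (rule refl)+
  show "nor_part z' p (c *\<^sub>R w) = c *\<^sub>R nor_part z' p w"
    unfolding planes_z'[OF p] by (rule nor_part_scaleR[OF q])
qed

text \<open>The scaling factors of \<sigma> and of the metric cancel in the mean curvature vector,
  and \<open>n2\<close> is determined by \<open>n1\<close> and the unchanged normal plane.\<close>

lemma normals_z':
  assumes p: "p \<in> W"
  shows "n1 z' p = n1 z (\<Phi> p)" "n2 z' p = n2 z (\<Phi> p)"
proof -
  have nz: "\<alpha> (\<Phi> p) \<noteq> 0" "\<beta> (\<Phi> p) \<noteq> 0" using pos_ab[OF \<Phi>_in(1)[OF p]] by auto
  have "n1 z' p = (1 / (2 * (coefE z' p * coefG z' p))) *\<^sub>R
    (coefG z' p *\<^sub>R nor_part z' p (Du (Du z') p) + coefE z' p *\<^sub>R nor_part z' p (Dv (Dv z') p))"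
    by (simp add: n1_def mean_curv_def sff_def coefs_z'(3)[OF p])
  also have "\<dots> = n1 z (\<Phi> p)"
    using nz EG_pos[OF \<Phi>_in(2)[OF p]] unfolding sigma_z'[OF p] coefs_z'[OF p] n1_eq[OF \<Phi>_in(2)[OF p]]
    by (simp add: scaleR_add_right field_simps)
  finally show 1: "n1 z' p = n1 z (\<Phi> p)" .
  show "n2 z' p = n2 z (\<Phi> p)" unfolding n2_def planes_z'(2)[OF p] 1 ..
qed

lemma local_param_z': "local_param M W z'"
  unfolding local_param_def
proof (intro conjI ballI)
  show "open W" by (rule W)
  show "smooth_on W z'" unfolding z'_def[abs_def] by (rule smooth_comp[OF smooth_V(1)])
  fix p assume p: "p \<in> W"
  have fd: "frechet_derivative z' (at p)
      = (\<lambda>h. frechet_derivative z (at (\<Phi> p)) (\<alpha> (\<Phi> p) * fst h, \<beta> (\<Phi> p) * snd h))"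
    using frechet_derivative_at[OF partials_comp(3)[OF p smooth_V(1)]] by (simp add: z'_def[abs_def])
  have "inj (frechet_derivative z (at (\<Phi> p)))" using local_param \<Phi>_in(2)[OF p] unfolding local_param_def by blast
  then show "inj (frechet_derivative z' (at p))"
    using pos_ab[OF \<Phi>_in(1)[OF p]] unfolding fd inj_def by (fastforce simp: prod_eq_iff)
next
  obtain w where w: "homeomorphism U (z ` U) z w" and o: "openin (top_of_set M) (z ` U)"
    using local_param unfolding local_param_def by blast
  have img: "z' ` W = z ` V"
    using homeo unfolding homeomorphism_def z'_def[abs_def] by (metis image_image)
  have "openin (top_of_set (z ` U)) (z ` V)"
    using homeomorphism_imp_open_map[OF w] V open_openin_trans[OF open_U V(1) V(2)]
    by (simp add: openin_open_eq open_U)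
  then show "openin (top_of_set M) (z' ` W)" unfolding img by (rule openin_trans[OF _ o])
  have "homeomorphism V (z ` V) z w"
    by (rule homeomorphism_of_subsets[OF w V(2)]) (use V in auto)
  from homeomorphism_compose[OF homeo this]
  show "\<exists>w. homeomorphism W (z' ` W) z' w" unfolding img unfolding z'_def[abs_def] comp_def by blast
qed

text \<open>As \<alpha> and \<beta> are positive, the unit fields x and y are the same in both
  charts, so the geometric functions are merely composed with \<Phi>.\<close>

lemma principal_z': "principal_params M W z' (\<lambda>p. \<nu> (\<Phi> p)) (\<lambda>p. l (\<Phi> p)) (\<lambda>p. \<mu> (\<Phi> p))"
  unfolding principal_params_def Let_def
proof (intro conjI ballI local_param_z' smooth_comp smooth_geo[THEN smooth_on_subset, OF V(2)])
  fix p assume p: "p \<in> W"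
  note q = \<Phi>_in(2)[OF p]
  show "coefF z' p = 0" by (rule coefs_z'[OF p])
  have nz: "\<alpha> (\<Phi> p) \<noteq> 0" "\<beta> (\<Phi> p) \<noteq> 0" "e (\<Phi> p) \<noteq> 0" "g (\<Phi> p) \<noteq> 0"
    using pos_ab[OF \<Phi>_in(1)[OF p]] eg_pos[OF q] by auto
  show "sff z' p (1 / sqrt (coefE z' p), 0) (1 / sqrt (coefE z' p), 0) = (1 + \<nu> (\<Phi> p)) *\<^sub>R n1 z' p"
    "sff z' p (1 / sqrt (coefE z' p), 0) (0, 1 / sqrt (coefG z' p)) = l (\<Phi> p) *\<^sub>R n1 z' p + \<mu> (\<Phi> p) *\<^sub>R n2 z' p"
    "sff z' p (0, 1 / sqrt (coefG z' p)) (0, 1 / sqrt (coefG z' p)) = (1 - \<nu> (\<Phi> p)) *\<^sub>R n1 z' p"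
    using nz by (simp_all add: sff_def coefs_z'(4,5)[OF p] sigma_z'[OF p] normals_z'[OF p] sigma[OF q])
  show "\<mu> (\<Phi> p) \<noteq> 0" by (rule mu_nonzero[OF q])
qed

end

text \<open>K^2 + \<kappa>^2 - \<mu>^2 = \<mu>^2 (4 \<nu>^2 + 4 \<lambda>^2 - 1).\<close>

lemma (in principal_chart) discriminant_nonzero:
  assumes "p \<in> U" "(gauss_curv z p)\<^sup>2 + (normal_curv z p)\<^sup>2 \<noteq> (\<mu> p)\<^sup>2"
  shows "4 * (\<nu> p)\<^sup>2 + 4 * (l p)\<^sup>2 - 1 \<noteq> 0"
proof
  assume "4 * (\<nu> p)\<^sup>2 + 4 * (l p)\<^sup>2 - 1 = 0"
  then have "(gauss_curv z p)\<^sup>2 + (normal_curv z p)\<^sup>2 = (\<mu> p)\<^sup>2"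
    unfolding gauss_curv[OF assms(1)] normal_curv[OF assms(1)] by algebra
  with assms(2) show False by simp
qed

theorem theorem3p3:
  fixes M :: "(real^4) set" and c1 c2 :: real
  assumes "marginally_trapped M"
    and "\<forall>q\<in>M. \<exists>U z \<nu> l \<mu>. principal_params M U z \<nu> l \<mu> \<and> q \<in> z ` U"
    and "\<forall>U z \<nu> l \<mu>. principal_params M U z \<nu> l \<mu> \<longrightarrow>
           (\<forall>p\<in>U. (gauss_curv z p)\<^sup>2 + (normal_curv z p)\<^sup>2 \<noteq> (\<mu> p)\<^sup>2)"
  shows "\<forall>q\<in>M. \<exists>U z \<nu> l \<mu> u0 v0.
           canonical_params M U z \<nu> l \<mu> u0 v0 c1 c2 \<and> z (u0, v0) = q"
proof
  fix q assume "q \<in> M"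
  then obtain U z \<nu> l \<mu> u0 v0 where pp: "principal_params M U z \<nu> l \<mu>" and base: "(u0, v0) \<in> U" "z (u0, v0) = q"
    using assms(2) by (metis imageE surj_pair)
  interpret principal_chart M U z \<nu> l \<mu> by unfold_locales (rule assms(1), rule pp)
  \<comment> \<open>The closed box lies in \<open>U\<close>, so the right sides of the differential
    equations are continuous and positive up to the end points, as
    \<open>autonomous_ode_interval\<close> asks.\<close>
  obtain a b c d where box: "a < u0" "u0 < b" "c < v0" "v0 < d" "{a..b} \<times> {c..d} \<subseteq> U"
    using open_contains_box[OF open_U base(1)] .
  define I J where "I = {a<..<b}" and "J = {c<..<d}"
  have IJ: "open I" "open J" "I \<times> J \<subseteq> U" "u0 \<in> I" "v0 \<in> J" "open (I \<times> J)"
    using box unfolding I_def J_def by (auto intro: open_Times)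
  \<comment> \<open>the functions \<open>\<phi>\<close> and \<open>\<psi>\<close> of the given chart, which the new parameters must absorb\<close>
  define w1 w2 where "w1 u = e (u, v0) * g (u0, v0) / g (u, v0) * exp c1"
    and "w2 v = g (u0, v) * e (u0, v0) / e (u0, v) * exp c2" for u v
  have U1: "(u, v0) \<in> U" if "u \<in> {a..b}" for u using that box by auto
  have U2: "(u0, v) \<in> U" if "v \<in> {c..d}" for v using that box by auto
  have pos: "0 < w1 u" if "u \<in> {a..b}" for u
    using eg_pos[OF U1[OF that]] eg_pos[OF base(1)] by (simp add: w1_def)
  have pos2: "0 < w2 v" if "v \<in> {c..d}" for v
    using eg_pos[OF U2[OF that]] eg_pos[OF base(1)] by (simp add: w2_def)
  note ceg = smooth_on_continuous[OF smooth_eg(1)] smooth_on_continuous[OF smooth_eg(2)]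
  have "continuous_on {a..b} (\<lambda>u. e (u, v0))" "continuous_on {a..b} (\<lambda>u. g (u, v0))"
    by (rule continuous_on_compose2[OF ceg(1)] continuous_on_compose2[OF ceg(2)];
        use U1 in \<open>auto intro!: continuous_intros\<close>)+
  then have "continuous_on {a..b} w1" unfolding w1_def
    by (intro continuous_intros) (use eg_pos U1 in force)+
  from autonomous_ode_interval[OF this pos]
  obtain T1 G P where T1: "open T1" "is_interval T1" "homeomorphism T1 I G P"
    "\<And>t. t \<in> T1 \<Longrightarrow> (G has_real_derivative inverse (w1 (G t))) (at t)" unfolding I_def by blast
  have "continuous_on {c..d} (\<lambda>v. e (u0, v))" "continuous_on {c..d} (\<lambda>v. g (u0, v))"
    by (rule continuous_on_compose2[OF ceg(1)] continuous_on_compose2[OF ceg(2)];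
        use U2 in \<open>auto intro!: continuous_intros\<close>)+
  then have "continuous_on {c..d} w2" unfolding w2_def
    by (intro continuous_intros) (use eg_pos U2 in force)+
  from autonomous_ode_interval[OF this pos2]
  obtain T2 H Q where T2: "open T2" "is_interval T2" "homeomorphism T2 J H Q"
    "\<And>t. t \<in> T2 \<Longrightarrow> (H has_real_derivative inverse (w2 (H t))) (at t)" unfolding J_def by blast
  \<comment> \<open>The derivatives of the solutions at the target point. Each involves one
    coordinate only, but \<open>diagonal_change\<close> takes functions on the box.\<close>
  define \<alpha> \<beta> :: "real \<times> real \<Rightarrow> real" where "\<alpha> p = inverse (w1 (fst p))" and "\<beta> p = inverse (w2 (snd p))" for p
  note sub = smooth_on_subset[OF _ IJ(3)]
  note fz = smooth_on_freeze_snd[OF IJ(1,2,5) sub[OF smooth_eg(1)]] smooth_on_freeze_snd[OF IJ(1,2,5) sub[OF smooth_eg(2)]]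
    smooth_on_freeze_fst[OF IJ(1,2,4) sub[OF smooth_eg(1)]] smooth_on_freeze_fst[OF IJ(1,2,4) sub[OF smooth_eg(2)]]
  have in_box: "fst p \<in> {a..b}" "snd p \<in> {c..d}" if "p \<in> I \<times> J" for p
    using that by (auto simp: I_def J_def)
  have egnz: "g (fst p, v0) \<noteq> 0" "e (u0, snd p) \<noteq> 0" if "p \<in> I \<times> J" for p
    using eg_pos(2)[OF U1[OF in_box(1)[OF that]]] eg_pos(1)[OF U2[OF in_box(2)[OF that]]] by auto
  have sw: "smooth_on (I \<times> J) (\<lambda>p. w1 (fst p))" "smooth_on (I \<times> J) (\<lambda>p. w2 (snd p))" unfolding w1_def w2_def
    by (rule smooth_on_mult[OF IJ(6) smooth_on_divide[OF IJ(6) smooth_on_mult[OF IJ(6) fz(1) smooth_on_const] fz(2) egnz(1)] smooth_on_const]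
        smooth_on_mult[OF IJ(6) smooth_on_divide[OF IJ(6) smooth_on_mult[OF IJ(6) fz(4) smooth_on_const] fz(3) egnz(2)] smooth_on_const]; assumption)+
  have wnz: "w1 (fst p) \<noteq> 0" "w2 (snd p) \<noteq> 0" if "p \<in> I \<times> J" for p
    using pos[OF in_box(1)[OF that]] pos2[OF in_box(2)[OF that]] by auto
  have s\<alpha>\<beta>: "smooth_on (I \<times> J) \<alpha>" "smooth_on (I \<times> J) \<beta>"
    unfolding \<alpha>_def[abs_def] \<beta>_def[abs_def]
    by (rule smooth_on_inverse[OF IJ(6) sw(1) wnz(1)] smooth_on_inverse[OF IJ(6) sw(2) wnz(2)]; assumption)+
  interpret diagonal_change M U z \<nu> l \<mu> "I \<times> J" "T1 \<times> T2" G H \<alpha> \<beta> "\<lambda>p. (P (fst p), Q (snd p))"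
    "\<lambda>p. (G (fst p), H (snd p))"
    by unfold_locales
      (use T1 T2 IJ s\<alpha>\<beta> pos[OF in_box(1)] pos2[OF in_box(2)] homeomorphism_map_prod[OF T1(3) T2(3)] in
        \<open>auto simp: \<alpha>_def \<beta>_def intro: open_Times\<close>)
  let ?\<Phi> = "\<lambda>p. (G (fst p), H (snd p))"
  \<comment> \<open>The new chart is entered as a principal chart in its own right, so its \<phi>_i
    need not be related to the old ones.\<close>
  interpret C: principal_chart M "T1 \<times> T2" z' "\<lambda>p. \<nu> (?\<Phi> p)" "\<lambda>p. l (?\<Phi> p)" "\<lambda>p. \<mu> (?\<Phi> p)"
    by unfold_locales (rule assms(1), rule principal_z')
  have \<Delta>: "4 * (\<nu> (?\<Phi> p))\<^sup>2 + 4 * (l (?\<Phi> p))\<^sup>2 - 1 \<noteq> 0" if "p \<in> T1 \<times> T2" for p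
    using C.discriminant_nonzero[OF that] assms(3) principal_z' that by blast
  \<comment> \<open>The primitives behind \<open>P\<close> and \<open>Q\<close> are not normalised;
    the base point simply receives whatever coordinates they assign to it.\<close>
  define s0 t0 where "s0 = P u0" and "t0 = Q v0"
  have st0: "s0 \<in> T1" "t0 \<in> T2" "G s0 = u0" "H t0 = v0"
    using T1(3) T2(3) IJ unfolding s0_def t0_def homeomorphism_def by auto
  have Ceg: "C.e p = \<alpha> (?\<Phi> p) * e (?\<Phi> p)" "C.g p = \<beta> (?\<Phi> p) * g (?\<Phi> p)" if "p \<in> T1 \<times> T2" for p
    unfolding C.e_def C.g_def by (rule coefs_z'[OF that])+
  have "can_phi z' (\<lambda>p. \<nu> (?\<Phi> p)) (\<lambda>p. l (?\<Phi> p)) (\<lambda>p. \<mu> (?\<Phi> p)) s0 t0 c1 (s, t) = 1"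
    "can_psi z' (\<lambda>p. \<nu> (?\<Phi> p)) (\<lambda>p. l (?\<Phi> p)) (\<lambda>p. \<mu> (?\<Phi> p)) s0 t0 c2 (s, t) = 1"
    if "(s, t) \<in> T1 \<times> T2" for s t
  proof -
    have st: "s \<in> T1" "t \<in> T2" using that by auto
    have GH: "G s \<in> I" "H t \<in> J" using st T1(3) T2(3) unfolding homeomorphism_def by auto
    have box': "G s \<in> {a..b}" "H t \<in> {c..d}" "u0 \<in> {a..b}" "v0 \<in> {c..d}"
      using GH box by (auto simp: I_def J_def)
    note p = pos[OF box'(1)] pos2[OF box'(2)] pos[OF box'(3)] pos2[OF box'(4)]
    note eg = eg_pos[OF U1[OF box'(1)]] eg_pos[OF U2[OF box'(2)]] eg_pos[OF base(1)]
    have base': "(s0, t0) \<in> T1 \<times> T2" using st0 by simp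
    have ci: "can_phi z' (\<lambda>p. \<nu> (?\<Phi> p)) (\<lambda>p. l (?\<Phi> p)) (\<lambda>p. \<mu> (?\<Phi> p)) s0 t0 c1 (s, t)
        = C.e (s, t0) * C.g (s0, t0) / C.g (s, t0) * exp c1"
      "can_psi z' (\<lambda>p. \<nu> (?\<Phi> p)) (\<lambda>p. l (?\<Phi> p)) (\<lambda>p. \<mu> (?\<Phi> p)) s0 t0 c2 (s, t)
        = C.g (s0, t) * C.e (s0, t0) / C.e (s0, t) * exp c2"
      by (rule C.canonical_integrals[OF refl T1(2) T2(2) base' that]; rule \<Delta>; assumption)+
    \<comment> \<open>The numerator and the denominator both carry the value of \<beta> at v0, which
      cancels; \<open>C.e\<close> supplies the factor 1 / w1, and the old quantities recombine to
      w1.\<close>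
    have "can_phi z' (\<lambda>p. \<nu> (?\<Phi> p)) (\<lambda>p. l (?\<Phi> p)) (\<lambda>p. \<mu> (?\<Phi> p)) s0 t0 c1 (s, t)
        = w1 (G s) / w1 (G s)"
      using p eg st0 st unfolding ci(1) by (simp add: Ceg \<alpha>_def \<beta>_def w1_def[of "G s"] field_simps)
    then show "can_phi z' (\<lambda>p. \<nu> (?\<Phi> p)) (\<lambda>p. l (?\<Phi> p)) (\<lambda>p. \<mu> (?\<Phi> p)) s0 t0 c1 (s, t) = 1"
      using p by simp
    have "can_psi z' (\<lambda>p. \<nu> (?\<Phi> p)) (\<lambda>p. l (?\<Phi> p)) (\<lambda>p. \<mu> (?\<Phi> p)) s0 t0 c2 (s, t)
        = w2 (H t) / w2 (H t)"
      using p eg st0 st unfolding ci(2) by (simp add: Ceg \<alpha>_def \<beta>_def w2_def[of "H t"] field_simps)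
    then show "can_psi z' (\<lambda>p. \<nu> (?\<Phi> p)) (\<lambda>p. l (?\<Phi> p)) (\<lambda>p. \<mu> (?\<Phi> p)) s0 t0 c2 (s, t) = 1"
      using p by simp
  qed
  then have "canonical_params M (T1 \<times> T2) z' (\<lambda>p. \<nu> (?\<Phi> p)) (\<lambda>p. l (?\<Phi> p)) (\<lambda>p. \<mu> (?\<Phi> p)) s0 t0 c1 c2"
    unfolding canonical_params_def using principal_z' T1(1,2) T2(1,2) st0 \<Delta> by blast
  moreover have "z' (s0, t0) = q" using st0 base by (simp add: z'_def)
  ultimately show "\<exists>U z \<nu> l \<mu> u0 v0. canonical_params M U z \<nu> l \<mu> u0 v0 c1 c2 \<and> z (u0, v0) = q"
    by blast
qed

end
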